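(* Let $N\ge 2$ be an integer and let $\tilde Y:=\{\frac{\pi}{N}(2j-1)\}_{j=1}^N\subset(0,2\pi)$. Then for every $N$-point set $Y=\{y_j\}_{j=1}^N$ with $0<y_1<\cdots<y_N<2\pi$ and every $\alpha<0$ one has $$\lambda_1(\alpha,Y)\le\lambda_1(\alpha,\tilde Y),$$ and the inequality is strict if and only if $Y$ is not congruent with $\tilde Y$. Here $\lambda_1(\alpha,Y)$ is the lowest eigenvalue of the operator $H_{\alpha,Y}$ describing $N$ point interactions of strength $\alpha$ located at the points of $Y$ on a loop of length $2\pi$.
   Context: Let $I=(0,2\pi)$. For $\alpha\in\mathbb{R}$ and $Y=\{y_j\}_{j=1}^N$ with $0<y_1<\cdots<y_N<2\pi$, the operator $H_{\alpha,Y}$, formally $-\frac{\mathrm{d}^2}{\mathrm{d}x^2}+\alpha\sum_{j=1}^N\delta(x-y_j)$ with periodic boundary conditions, is the unique self-adjoint operator in $L^2(I)$ associated with the quadratic form $$q_{\alpha,Y}(\psi)=\|\psi'\|^2+\alpha\sum_{j=1}^N|\psi(y_j)|^2$$ defined on the functions $\psi\in H^1(I)$ with $\psi(0+)=\psi(2\pi-)$. Equivalently, it acts as $-\psi''$ away from $Y$ on functions that are $H^2$ on each component of $I\setminus Y$ and satisfy $\psi(y_j+)=\psi(y_j-)=:\psi(y_j)$ and $\psi'(y_j+)-\psi'(y_j-)=\alpha\psi(y_j)$ for $j=1,\dots,N$, together with $\psi(2\pi-)=\psi(0+)$ and $\psi'(2\pi-)=\psi'(0+)$. Its spectrum is purely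 discrete; $\lambda_1(\alpha,Y)$ denotes its smallest eigenvalue. Two $N$-point sets are called congruent if, viewed as subsets of the loop $\mathbb{R}/2\pi\mathbb{Z}$ with its arc-length metric, one is mapped onto the other by an isometry of the loop. *)

theory Defs
  imports "HOL-Analysis.Analysis"
begin

definition loop_measure :: "real measure" where
  "loop_measure = restrict_space lborel {0<..<2 * pi}"

(* Elements of L^2(0,2 pi) are represented by Borel functions; only their a.e. classes matter. *)
definition L2 :: "(real \<Rightarrow> complex) set" where
  "L2 = {f. f \<in> borel_measurable loop_measure \<and> integrable loop_measure (\<lambda>x. (cmod (f x))\<^sup>2)}"

definition L2_inner :: "(real \<Rightarrow> complex) \<Rightarrow> (real \<Rightarrow> complex) \<Rightarrow> complex" where
  "L2_inner f g = (\<integral>x. cnj (f x) * g x \<partial>loop_measure)"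

(* psi is absolutely continuous on [0,2 pi] with derivative g in L^2(0,2 pi). *)
definition has_L2_deriv :: "(real \<Rightarrow> complex) \<Rightarrow> (real \<Rightarrow> complex) \<Rightarrow> bool" where
  "has_L2_deriv \<psi> g \<longleftrightarrow>
     g \<in> L2 \<and> (\<forall>x\<in>{0..2 * pi}. \<psi> x = \<psi> 0 + (LINT t:{0<..<x}|lborel. g t))"

(* H^1(0,2 pi): a class in H^1 is represented by its absolutely continuous representative,
   extended to the closed interval, so that psi 0 = psi(0+) and psi (2 pi) = psi(2 pi -). *)
definition H1 :: "(real \<Rightarrow> complex) set" where
  "H1 = {\<psi>. \<exists>g. has_L2_deriv \<psi> g}"

(* Unique up to null sets on H1. *)
definition L2_deriv :: "(real \<Rightarrow> complex) \<Rightarrow> real \<Rightarrow> complex" where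
  "L2_deriv \<psi> = (SOME g. has_L2_deriv \<psi> g)"

definition form_domain :: "(real \<Rightarrow> complex) set" where
  "form_domain = {\<psi> \<in> H1. \<psi> 0 = \<psi> (2 * pi)}"

(* The sesquilinear form obtained from the quadratic form q by polarization, see form_diag. *)
definition form :: "real \<Rightarrow> real set \<Rightarrow> (real \<Rightarrow> complex) \<Rightarrow> (real \<Rightarrow> complex) \<Rightarrow> complex" where
  "form \<alpha> Y \<phi> \<psi> =
     L2_inner (L2_deriv \<phi>) (L2_deriv \<psi>) + of_real \<alpha> * (\<Sum>y\<in>Y. cnj (\<phi> y) * \<psi> y)"

lemma form_diag:
  "form \<alpha> Y \<psi> \<psi> =
     of_real ((\<integral>x. (cmod (L2_deriv \<psi> x))\<^sup>2 \<partial>loop_measure) + \<alpha> * (\<Sum>y\<in>Y. (cmod (\<psi> y))\<^sup>2))"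
proof -
  have *: "cnj z * z = of_real ((cmod z)\<^sup>2)" for z
    by (metis complex_norm_square mult.commute)
  show ?thesis
    unfolding form_def L2_inner_def * integral_complex_of_real by simp
qed

(* Graph of the self-adjoint operator associated with the form (first representation theorem):
   psi is in the domain and is mapped to eta iff form(phi, psi) = (phi, eta) for all phi in the
   form domain. *)
definition H_graph :: "real \<Rightarrow> real set \<Rightarrow> ((real \<Rightarrow> complex) \<times> (real \<Rightarrow> complex)) set" where
  "H_graph \<alpha> Y = {(\<psi>, \<eta>). \<psi> \<in> form_domain \<and> \<eta> \<in> L2 \<and>
      (\<forall>\<phi>\<in>form_domain. form \<alpha> Y \<phi> \<psi> = L2_inner \<phi> \<eta>)}"

(* As the operator is self-adjoint, only real eigenvalues occur. *)
definition is_eigenvalue :: "real \<Rightarrow> real set \<Rightarrow> real \<Rightarrow> bool" where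
  "is_eigenvalue \<alpha> Y \<mu> \<longleftrightarrow>
     (\<exists>\<psi>. (\<psi>, \<lambda>x. of_real \<mu> * \<psi> x) \<in> H_graph \<alpha> Y \<and> \<not> (AE x in loop_measure. \<psi> x = 0))"

definition lambda1 :: "real \<Rightarrow> real set \<Rightarrow> real" where
  "lambda1 \<alpha> Y = (LEAST \<mu>. is_eigenvalue \<alpha> Y \<mu>)"

(* The loop R / 2 pi Z is represented by the fundamental domain [0,2 pi). *)
definition loop :: "real set" where
  "loop = {0..<2 * pi}"

definition arc_dist :: "real \<Rightarrow> real \<Rightarrow> real" where
  "arc_dist x y = min \<bar>x - y\<bar> (2 * pi - \<bar>x - y\<bar>)"

definition loop_isometry :: "(real \<Rightarrow> real) \<Rightarrow> bool" where
  "loop_isometry f \<longleftrightarrow>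
     bij_betw f loop loop \<and> (\<forall>x\<in>loop. \<forall>y\<in>loop. arc_dist (f x) (f y) = arc_dist x y)"

definition congruent_sets :: "real set \<Rightarrow> real set \<Rightarrow> bool" where
  "congruent_sets Y Z \<longleftrightarrow> (\<exists>f. loop_isometry f \<and> f ` Y = Z)"

definition Y_tilde :: "nat \<Rightarrow> real set" where
  "Y_tilde N = (\<lambda>j. pi / real N * (2 * real j - 1)) ` {1..N}"

end

theory Submission
  imports Defs
begin

text \<open>A number \<open>- \<kappa>\<^sup>2 < 0\<close> is an eigenvalue iff \<open>- 1 / \<alpha>\<close> is an eigenvalue of the matrix
  \<open>G\<^sub>\<kappa>(\<bar>x - y\<bar>)\<close>, \<open>x, y \<in> Y\<close>, where \<open>G\<^sub>\<kappa>(d) = cosh (\<kappa> (\<pi> - d)) / (2 \<kappa> sinh (\<kappa> \<pi>))\<close> is the periodic Green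
  function: its translates reproduce point values in the form domain. Hence the lowest
  eigenvalue corresponds to the largest \<open>\<kappa>\<close> for which the top eigenvalue of the matrix reaches
  \<open>- 1 / \<alpha>\<close>. For the equidistant set all row sums agree and bound the top eigenvalue. For general
  \<open>Y\<close> the test vector of ones bounds it from below: the sum of all matrix entries is grouped by
  cyclic offset, and for each offset the distances have a fixed sum, so strict convexity of
  \<open>G\<^sub>\<kappa>\<close> shows that equidistant points are the strict minimizer.\<close>

section \<open>Quadratic forms depending on a parameter\<close>

text \<open>The two sets are compared at a single parameter, the critical \<kappa>' of the
  equidistant set. There the vector of ones lifts the quadratic form of a non-congruent
  \<open>Y\<close> strictly above the critical level, so the last crossing for \<open>Y\<close>
  comes strictly later, which means a strictly lower eigenvalue. Crossings exist because of the two
  ends of the parameter range: the diagonal entry of the matrix is at least 1/(2 \<kappa>), while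
  for \<kappa> >= 1 every entry is at most 1/\<kappa>. \<open>lambda1\<close> is a
  \<open>LEAST\<close> over all eigenvalues, so a minimum has to be exhibited. The last crossing
  supplies one, and eigenvalues above it need no analysis. The analytic obstacle is that form domain
  elements are only absolutely continuous and their derivative is known only up to null sets. The
  Green function identity is therefore proved in weak form, by Fubini, and all use of the
  differential equation passes through it.\<close>

definition quad :: "('a \<Rightarrow> 'a \<Rightarrow> real) \<Rightarrow> 'a set \<Rightarrow> ('a \<Rightarrow> real) \<Rightarrow> real" where
  "quad G Y a = (\<Sum>x\<in>Y. \<Sum>y\<in>Y. G x y * a x * a y)"

text \<open>For small \<open>t\<close> the linear term outweighs the quadratic one, so a nonzero
  \<open>b\<close> would make the expression negative.\<close>

lemma nonneg_affine_quadratic_imp_0: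
  fixes b c :: real
  assumes "\<And>t. 2 * t * b + t\<^sup>2 * c \<ge> 0"
  shows "b = 0"
proof (rule ccontr)
  assume b: "b \<noteq> 0"
  \<comment> \<open>The shift by 1 makes \<open>d\<close> positive and larger than \<open>c\<close>,
    so the value at \<open>t = - b / d\<close> is negative whatever the sign of
    \<open>c\<close>.\<close>
  define d where "d = \<bar>c\<bar> + 1"
  have d: "d > 0" "c < d" by (auto simp: d_def)
  have "2 * (- b / d) * b + (- b / d)\<^sup>2 * c = b\<^sup>2 / d * (c / d - 2)"
    using d by (simp add: field_simps power2_eq_square)
  also have "\<dots> < 0"
    using b d by (intro mult_pos_neg) (auto simp: field_simps)
  finally show False using assms[of "- b / d"] by simp
qed

text \<open>First-order condition for a maximal Rayleigh quotient: moving \<open>a\<close> by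
  \<open>t\<close> in the coordinate direction \<open>y\<close> leaves a nonnegative gap below level
  \<open>c\<close>. This gap is quadratic in \<open>t\<close> without constant term, so its linear
  coefficient vanishes.\<close>

lemma quad_maximizer_eigenvector:
  assumes Y: "finite Y" and sym: "\<And>x y. G x y = G y x"
    and max: "\<And>a. quad G Y a \<le> c * (\<Sum>x\<in>Y. (a x)\<^sup>2)"
    and eq: "quad G Y a = c * (\<Sum>x\<in>Y. (a x)\<^sup>2)"
    and y: "y \<in> Y"
  shows "(\<Sum>x\<in>Y. G y x * a x) = c * a y"
proof -
  let ?e = "\<lambda>x. if x = y then 1 else 0 :: real"
  define B where "B = c * a y - (\<Sum>x\<in>Y. G y x * a x)"
  have "2 * t * B + t\<^sup>2 * (c - G y y) \<ge> 0" for t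
  proof -
    have dsum: "(\<Sum>x\<in>Y. f x * ?e x) = f y" for f :: "'a \<Rightarrow> real"
    proof -
      have "(\<Sum>x\<in>Y. f x * ?e x) = (\<Sum>x\<in>Y. if x = y then f x else 0)"
        by (rule sum.cong) auto
      then show ?thesis using y Y by simp
    qed
    have 1: "(\<Sum>x\<in>Y. (a x + t * ?e x)\<^sup>2) = (\<Sum>x\<in>Y. (a x)\<^sup>2) + 2 * t * a y + t\<^sup>2"
    proof -
      have "(a x + t * ?e x)\<^sup>2 = (a x)\<^sup>2 + (2 * t * a x + t\<^sup>2) * ?e x" for x
        by (simp add: power2_eq_square algebra_simps)
      then show ?thesis by (simp only: sum.distrib dsum)
    qed
    have "quad G Y (\<lambda>x. a x + t * ?e x) =
        (\<Sum>x\<in>Y. \<Sum>z\<in>Y. G x z * a x * a z) + (\<Sum>x\<in>Y. \<Sum>z\<in>Y. (t * G x z * a x) * ?e z) +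
        (\<Sum>x\<in>Y. (\<Sum>z\<in>Y. t * G x z * a z) * ?e x) + (\<Sum>x\<in>Y. (\<Sum>z\<in>Y. (t\<^sup>2 * G x z) * ?e z) * ?e x)"
      unfolding quad_def sum_distrib_right sum.distrib[symmetric]
      by (intro sum.cong refl) (simp add: algebra_simps power2_eq_square)
    also have "\<dots> = quad G Y a + t * (\<Sum>x\<in>Y. G x y * a x) + t * (\<Sum>z\<in>Y. G y z * a z) + t\<^sup>2 * G y y"
      by (simp only: dsum) (simp add: quad_def sum_distrib_left mult_ac)
    also have "(\<Sum>x\<in>Y. G x y * a x) = (\<Sum>x\<in>Y. G y x * a x)"
      by (rule sum.cong[OF refl]) (metis sym)
    finally have 2: "quad G Y (\<lambda>x. a x + t * ?e x) = quad G Y a + 2 * t * (\<Sum>z\<in>Y. G y z * a z) + t\<^sup>2 * G y y"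
      by simp
    show ?thesis
      using max[of "\<lambda>x. a x + t * ?e x"] unfolding 1 2 eq by (simp add: B_def algebra_simps)
  qed
  then have "B = 0" by (rule nonneg_affine_quadratic_imp_0)
  then show ?thesis by (simp add: B_def)
qed

lemma quad_eigenvector:
  assumes "\<And>y. y \<in> Y \<Longrightarrow> (\<Sum>x\<in>Y. G y x * a x) = c * a y"
  shows "quad G Y a = c * (\<Sum>x\<in>Y. (a x)\<^sup>2)"
proof -
  have "quad G Y a = (\<Sum>y\<in>Y. a y * (\<Sum>x\<in>Y. G y x * a x))"
    unfolding quad_def sum_distrib_left by (simp add: mult_ac)
  also have "\<dots> = (\<Sum>y\<in>Y. c * (a y)\<^sup>2)"
    using assms by (intro sum.cong refl) (simp add: power2_eq_square)
  finally show ?thesis by (simp add: sum_distrib_left)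
qed

lemma sum_power2_pos:
  fixes a :: "'a \<Rightarrow> real"
  assumes "finite Y" "\<exists>x\<in>Y. a x \<noteq> 0"
  shows "0 < (\<Sum>x\<in>Y. (a x)\<^sup>2)"
proof -
  from assms(2) obtain x where x: "x \<in> Y" "a x \<noteq> 0" by blast
  then have "0 < (a x)\<^sup>2" by simp
  also have "\<dots> \<le> (\<Sum>x\<in>Y. (a x)\<^sup>2)" using assms(1) x by (intro member_le_sum) auto
  finally show ?thesis .
qed

text \<open>Vectors are total functions on a possibly infinite type. Forcing them to 0 off
  \<open>Y\<close> places the sphere in a product of compact sets, where Tychonoff's theorem
  applies.\<close>

lemma compact_unit_vectors:
  assumes "finite Y"
  shows "compact {a :: 'a \<Rightarrow> real. (\<forall>x. x \<notin> Y \<longrightarrow> a x = 0) \<and> (\<Sum>x\<in>Y. (a x)\<^sup>2) = 1}"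
proof -
  let ?B = "\<lambda>x. if x \<in> Y then {-1..1} else {0 :: real}"
  have "compactin (product_topology (\<lambda>i. euclidean :: real topology) UNIV) (PiE UNIV ?B)"
    unfolding compactin_PiE by auto
  then have 1: "compact (PiE UNIV ?B)"
    by (simp add: euclidean_product_topology)
  have 2: "closed {a :: 'a \<Rightarrow> real. (\<Sum>x\<in>Y. (a x)\<^sup>2) = 1}"
    by (intro closed_Collect_eq continuous_intros) auto
  have "{a :: 'a \<Rightarrow> real. (\<forall>x. x \<notin> Y \<longrightarrow> a x = 0) \<and> (\<Sum>x\<in>Y. (a x)\<^sup>2) = 1} =
      PiE UNIV ?B \<inter> {a. (\<Sum>x\<in>Y. (a x)\<^sup>2) = 1}"
  proof (intro equalityI subsetI)
    fix a :: "'a \<Rightarrow> real" assume a: "a \<in> {a. (\<forall>x. x \<notin> Y \<longrightarrow> a x = 0) \<and> (\<Sum>x\<in>Y. (a x)\<^sup>2) = 1}"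
    have "\<bar>a x\<bar> \<le> 1" if "x \<in> Y" for x
    proof -
      have "(a x)\<^sup>2 \<le> (\<Sum>x\<in>Y. (a x)\<^sup>2)"
        using assms that by (intro member_le_sum) auto
      then show ?thesis using a by (simp add: abs_square_le_1)
    qed
    then show "a \<in> PiE UNIV ?B \<inter> {a. (\<Sum>x\<in>Y. (a x)\<^sup>2) = 1}"
      using a by (auto simp: abs_le_iff)
  qed (auto simp: PiE_iff split: if_splits)
  then show ?thesis using compact_Int_closed[OF 1 2] by simp
qed

text \<open>A compactness argument yields the last parameter at which the largest eigenvalue of the family
  reaches the level \<open>c\<close>; by continuity it equals \<open>c\<close> there. No monotonicity in the parameter is
  needed.\<close>

lemma quad_last_crossing:
  fixes G :: "real \<Rightarrow> 'a \<Rightarrow> 'a \<Rightarrow> real"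
  assumes Y: "finite Y"
    and cont: "\<And>x y. continuous_on {0<..} (\<lambda>k. G k x y)"
    and bound: "\<And>k a. k \<ge> K \<Longrightarrow> \<exists>x\<in>Y. a x \<noteq> 0 \<Longrightarrow> quad (G k) Y a < c * (\<Sum>x\<in>Y. (a x)\<^sup>2)"
    and k0: "k0 > 0" "\<exists>x\<in>Y. a0 x \<noteq> 0" "quad (G k0) Y a0 \<ge> c * (\<Sum>x\<in>Y. (a0 x)\<^sup>2)"
  obtains k a where "k \<ge> k0" "\<exists>x\<in>Y. a x \<noteq> 0"
    "quad (G k) Y a = c * (\<Sum>x\<in>Y. (a x)\<^sup>2)"
    "\<And>a. quad (G k) Y a \<le> c * (\<Sum>x\<in>Y. (a x)\<^sup>2)"
    "\<And>k' a. k' > k \<Longrightarrow> \<exists>x\<in>Y. a x \<noteq> 0 \<Longrightarrow> quad (G k') Y a < c * (\<Sum>x\<in>Y. (a x)\<^sup>2)"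
proof -
  define S where "S = {a :: 'a \<Rightarrow> real. (\<forall>x. x \<notin> Y \<longrightarrow> a x = 0) \<and> (\<Sum>x\<in>Y. (a x)\<^sup>2) = 1}"
  \<comment> \<open>Pairs of a parameter and a unit vector that reach level \<open>c\<close>; the
    last crossing is the largest first coordinate in this compact set. The bound
    \<open>max k0 K\<close> keeps \<open>k0\<close> in the interval even when
    \<open>K < k0\<close>.\<close>
  define M where "M = {k0..max k0 K} \<times> S \<inter> (\<lambda>p. quad (G (fst p)) Y (snd p)) -` {c..}"
  have S: "compact S" unfolding S_def by (rule compact_unit_vectors[OF Y])
  have normalize: "\<exists>b\<in>S. \<forall>G. quad G Y b = quad G Y a / (\<Sum>x\<in>Y. (a x)\<^sup>2)" and pos: "(\<Sum>x\<in>Y. (a x)\<^sup>2) > 0"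
    if "\<exists>x\<in>Y. a x \<noteq> 0" for a
  proof -
    show pos: "(\<Sum>x\<in>Y. (a x)\<^sup>2) > 0" by (rule sum_power2_pos[OF Y that])
    define n where "n = sqrt (\<Sum>x\<in>Y. (a x)\<^sup>2)"
    have n: "n\<^sup>2 = (\<Sum>x\<in>Y. (a x)\<^sup>2)" using pos by (simp add: n_def)
    define b where "b x = (if x \<in> Y then a x / n else 0)" for x
    have 1: "(\<Sum>x\<in>Y. (b x)\<^sup>2) = 1"
    proof -
      have "(\<Sum>x\<in>Y. (b x)\<^sup>2) = (\<Sum>x\<in>Y. (a x)\<^sup>2 / n\<^sup>2)"
        by (intro sum.cong refl) (simp add: b_def power_divide)
      also have "\<dots> = (\<Sum>x\<in>Y. (a x)\<^sup>2) / n\<^sup>2" by (rule sum_divide_distrib[symmetric])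
      finally show ?thesis using pos by (simp add: n)
    qed
    have "quad G Y b = quad G Y a / n\<^sup>2" for G
      unfolding quad_def sum_divide_distrib
      by (intro sum.cong refl) (simp add: b_def power2_eq_square)
    then show "\<exists>b\<in>S. \<forall>G. quad G Y b = quad G Y a / (\<Sum>x\<in>Y. (a x)\<^sup>2)"
      using 1 unfolding n by (intro bexI[of _ b]) (auto simp: S_def b_def)
  qed
  have SY: "\<exists>x\<in>Y. a x \<noteq> 0" if "a \<in> S" for a
  proof (rule ccontr)
    assume "\<not> (\<exists>x\<in>Y. a x \<noteq> 0)"
    then have "(\<Sum>x\<in>Y. (a x)\<^sup>2) = 0" by simp
    then show False using that by (simp add: S_def)
  qed
  have contQ: "continuous_on ({k0..max k0 K} \<times> S) (\<lambda>p. quad (G (fst p)) Y (snd p))"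
    unfolding quad_def
  proof (intro continuous_intros)
    fix x y
    show "continuous_on ({k0..max k0 K} \<times> S) (\<lambda>p. G (fst p) x y)"
      by (rule continuous_on_compose2[OF cont]) (use k0 in \<open>auto intro!: continuous_intros\<close>)
    have coord: "continuous_on ({k0..max k0 K} \<times> S) (\<lambda>p. snd p x)" for x
      by (rule continuous_on_product_then_coordinatewise) (intro continuous_intros)
    show "continuous_on ({k0..max k0 K} \<times> S) (\<lambda>p. snd p x)"
      "continuous_on ({k0..max k0 K} \<times> S) (\<lambda>p. snd p y)" by (rule coord)+
  qed
  have "compact ({k0..max k0 K} \<times> S)"
    by (intro compact_Times S) auto
  then have "compact M"
    unfolding M_def by (rule closedin_compact) (intro continuous_closedin_preimage contQ closed_atLeast)
  moreover have "M \<noteq> {}"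
  proof -
    from normalize[OF k0(2)] obtain b where b: "b \<in> S" "quad (G k0) Y b = quad (G k0) Y a0 / (\<Sum>x\<in>Y. (a0 x)\<^sup>2)" by blast
    have "quad (G k0) Y b \<ge> c" unfolding b(2) using k0(3) pos[OF k0(2)] by (simp add: field_simps)
    then have "(k0, b) \<in> M" using b(1) by (auto simp: M_def)
    then show ?thesis by blast
  qed
  ultimately obtain p where p: "p \<in> M" "\<And>q. q \<in> M \<Longrightarrow> fst q \<le> fst p"
    using continuous_attains_sup[of M fst] continuous_on_fst[OF continuous_on_id] by blast
  obtain k a where [simp]: "p = (k, a)" by (cases p)
  have ka: "k0 \<le> k" "k \<le> max k0 K" "a \<in> S" "quad (G k) Y a \<ge> c"
    using p(1) by (auto simp: M_def)
  have above: "quad (G k') Y a < c * (\<Sum>x\<in>Y. (a x)\<^sup>2)" if k': "k' > k" and a: "\<exists>x\<in>Y. a x \<noteq> 0" for k' a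
  proof (cases "k' \<ge> K")
    case True
    then show ?thesis using bound a by blast
  next
    case False
    from normalize[OF a] obtain b where b: "b \<in> S" "quad (G k') Y b = quad (G k') Y a / (\<Sum>x\<in>Y. (a x)\<^sup>2)" by blast
    have "(k', b) \<notin> M" using p(2)[of "(k', b)"] k' by auto
    then have "quad (G k') Y b < c" using b(1) ka k' False by (auto simp: M_def)
    then show ?thesis unfolding b(2) using pos[OF a] by (simp add: field_simps)
  qed
  have le: "quad (G k) Y a \<le> c * (\<Sum>x\<in>Y. (a x)\<^sup>2)" for a
  proof (cases "\<exists>x\<in>Y. a x \<noteq> 0")
    case True
    have "continuous_on {0<..} (\<lambda>k. quad (G k) Y a)"
      unfolding quad_def by (intro continuous_intros cont)
    then have "isCont (\<lambda>k. quad (G k) Y a) k"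
      using ka(1) k0(1) by (simp add: continuous_on_eq_continuous_at)
    \<comment> \<open>The bounds are known only beyond \<open>k\<close>, so they are passed to the
      limit from the right.\<close>
    then have "((\<lambda>k. quad (G k) Y a) \<longlongrightarrow> quad (G k) Y a) (at_right k)"
      unfolding isCont_def by (rule tendsto_mono[OF at_le, rotated]) simp
    moreover have "\<forall>\<^sub>F k' in at_right k. quad (G k') Y a \<le> c * (\<Sum>x\<in>Y. (a x)\<^sup>2)"
      unfolding eventually_at_filter
      by (rule always_eventually) (use above[OF _ True] in \<open>simp add: less_imp_le\<close>)
    ultimately show ?thesis
      by (rule tendsto_upperbound) simp
  qed (simp add: quad_def)
  show thesis
  proof (rule that[of k a])
    show "quad (G k) Y a = c * (\<Sum>x\<in>Y. (a x)\<^sup>2)"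
      using le[of a] ka(3,4) by (simp add: S_def)
    show "\<exists>x\<in>Y. a x \<noteq> 0" by (rule SY[OF ka(3)])
  qed (fact ka(1) le above)+
qed

section \<open>Weak derivatives on the loop\<close>

text \<open>Half-lines are closed under intersection and generate the Borel sets, so a Dynkin-system
  argument extends the vanishing to all Borel sets. It serves to show that a primitive determines
  its derivative almost everywhere.\<close>

lemma AE_eq_0_if_integral_lessThan_eq_0:
  fixes f :: "real \<Rightarrow> 'b::{second_countable_topology, banach}"
  assumes f: "integrable lborel f"
    and zero: "\<And>x. (LINT t:{..<x}|lborel. f t) = 0"
  shows "AE x in lborel. f x = 0"
proof (rule sigma_finite_measure.density_zero[OF sigma_finite_lborel f])
  have int: "set_integrable lborel B f" if "B \<in> sets borel" for B
    using that f unfolding set_integrable_def by (intro integrable_mult_indicator) auto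
  \<comment> \<open>Closure under complements needs the integral over the whole line to vanish as
    well.\<close>
  have "(\<lambda>n. LINT t:{..<real n}|lborel. f t) \<longlonglongrightarrow> (LINT t:UNIV|lborel. f t)"
    unfolding set_lebesgue_integral_def
  proof (rule integral_dominated_convergence[where w="\<lambda>x. norm (f x)"])
    show "AE x in lborel. (\<lambda>n. indicat_real {..<real n} x *\<^sub>R f x) \<longlonglongrightarrow> indicat_real UNIV x *\<^sub>R f x"
    proof (rule AE_I2)
      fix x :: real
      have "\<forall>\<^sub>F n in sequentially. x < real n"
        by (metis filterlim_at_top_dense filterlim_real_sequentially)
      then have "\<forall>\<^sub>F n in sequentially. indicat_real {..<real n} x *\<^sub>R f x = indicat_real UNIV x *\<^sub>R f x"
        by eventually_elim simp
      then show "(\<lambda>n. indicat_real {..<real n} x *\<^sub>R f x) \<longlonglongrightarrow> indicat_real UNIV x *\<^sub>R f x"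
        by (rule tendsto_eventually)
    qed
  qed (use f borel_measurable_integrable[OF f] in \<open>simp_all add: indicator_def\<close>)
  then have UNIV_0: "(LINT t:UNIV|lborel. f t) = 0"
    unfolding zero by (rule LIMSEQ_unique[OF _ tendsto_const])
  have gen: "sets lborel = sigma_sets UNIV (range lessThan :: real set set)"
    by (simp add: borel_Iio)
  fix A :: "real set" assume "A \<in> sets lborel"
  then have A: "A \<in> sigma_sets UNIV (range lessThan)" unfolding gen .
  have "Int_stable (range lessThan :: real set set)"
    unfolding Int_stable_def
  proof (intro ballI)
    fix A B :: "real set" assume "A \<in> range lessThan" "B \<in> range lessThan"
    then obtain a b where "A = {..<a}" "B = {..<b}" by blast
    then have "A \<inter> B = {..<min a b}" by auto
    then show "A \<inter> B \<in> range lessThan" by blast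
  qed
  from this subset_UNIV[of "range lessThan :: real set set", folded Pow_UNIV] A
  show "(LINT t:A|lborel. f t) = 0"
  proof (induction rule: sigma_sets_induct_disjoint)
    case (compl A)
    then have A: "A \<in> sets borel" using gen by simp
    then have "(LINT t:A \<union> (UNIV - A)|lborel. f t) = (LINT t:A|lborel. f t) + (LINT t:UNIV - A|lborel. f t)"
      by (intro set_integral_Un int) auto
    then show ?case using compl.IH UNIV_0 by simp
  next
    case (union A)
    then have A: "A i \<in> sets borel" for i using gen by (metis range_subsetD sets_lborel)
    have "(LINT t:(\<Union>i. A i)|lborel. f t) = (\<Sum>i. LINT t:A i|lborel. f t)"
      using A union.hyps(1) by (intro lebesgue_integral_countable_add int) (auto simp: disjoint_family_on_def)
    then show ?case using union.IH by simp
  qed (use zero in \<open>auto simp: set_lebesgue_integral_def\<close>)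
qed

text \<open>Integration by parts for the primitive of a merely integrable function: both sides
  integrate \<open>k t *\<^sub>R g s\<close> over the half-plane \<open>s < t\<close>.\<close>

lemma integral_mult_primitive:
  fixes g :: "real \<Rightarrow> complex" and k :: "real \<Rightarrow> real"
  assumes g: "integrable lborel g" and k: "integrable lborel k"
  shows "integrable lborel (\<lambda>t. k t *\<^sub>R (LINT s:{..<t}|lborel. g s))"
    and "(\<integral>t. k t *\<^sub>R (LINT s:{..<t}|lborel. g s) \<partial>lborel) = (\<integral>s. (LINT t:{s<..}|lborel. k t) *\<^sub>R g s \<partial>lborel)"
proof -
  have [measurable]: "g \<in> borel_measurable borel" "k \<in> borel_measurable borel"
    using g k by auto
  let ?F = "\<lambda>t s. indicator {x. fst x > snd x} (t, s) *\<^sub>R (k t *\<^sub>R g s)"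
  have prod: "integrable (lborel \<Otimes>\<^sub>M lborel) (\<lambda>(t, s). k t *\<^sub>R g s)"
  proof (rule lborel_pair.Fubini_integrable)
    show "integrable lborel (\<lambda>x. \<integral>y. norm (case (x, y) of (t, s) \<Rightarrow> k t *\<^sub>R g s) \<partial>lborel)"
      using k by simp
  qed (use g in auto)
  have F: "integrable (lborel \<Otimes>\<^sub>M lborel) (case_prod ?F)"
  proof -
    have "{x. snd x < fst x} \<in> sets (borel \<Otimes>\<^sub>M borel :: (real \<times> real) measure)"
      unfolding borel_prod by (intro borel_open open_Collect_less continuous_intros)
    then have *: "{x. snd x < fst x} \<in> sets (lborel \<Otimes>\<^sub>M lborel :: (real \<times> real) measure)"
      by (simp only: sets_pair_measure_cong[OF sets_lborel sets_lborel])
    have "case_prod ?F = (\<lambda>x. indicator {x. snd x < fst x} x *\<^sub>R (case x of (t, s) \<Rightarrow> k t *\<^sub>R g s))"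
      by (auto simp: fun_eq_iff)
    then show ?thesis
      using integrable_mult_indicator[OF * prod] by simp
  qed
  have 1: "(\<lambda>t. k t *\<^sub>R (LINT s:{..<t}|lborel. g s)) = (\<lambda>t. \<integral>s. ?F t s \<partial>lborel)"
  proof
    fix t
    have "?F t s = k t *\<^sub>R (indicator {..<t} s *\<^sub>R g s)" for s
      by (simp add: indicator_def)
    then show "k t *\<^sub>R (LINT s:{..<t}|lborel. g s) = (\<integral>s. ?F t s \<partial>lborel)"
      unfolding set_lebesgue_integral_def by (simp only: integral_scaleR_right)
  qed
  have "(LINT t:{s<..}|lborel. k t) *\<^sub>R g s = (\<integral>t. ?F t s \<partial>lborel)" for s
  proof -
    have "integrable lborel (\<lambda>t. indicator {s<..} t *\<^sub>R k t)"
      using k by (intro integrable_mult_indicator) auto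
    then have "(LINT t:{s<..}|lborel. k t) *\<^sub>R g s = (\<integral>t. (indicator {s<..} t *\<^sub>R k t) *\<^sub>R g s \<partial>lborel)"
      unfolding set_lebesgue_integral_def by (subst integral_scaleR_left) simp_all
    also have "\<dots> = (\<integral>t. ?F t s \<partial>lborel)"
      by (rule Bochner_Integration.integral_cong) (simp_all add: indicator_def)
    finally show ?thesis .
  qed
  then have 2: "(\<lambda>s. (LINT t:{s<..}|lborel. k t) *\<^sub>R g s) = (\<lambda>s. \<integral>t. ?F t s \<partial>lborel)" by auto
  show "integrable lborel (\<lambda>t. k t *\<^sub>R (LINT s:{..<t}|lborel. g s))"
    unfolding 1 by (rule lborel_pair.integrable_fst[OF F])
  show "(\<integral>t. k t *\<^sub>R (LINT s:{..<t}|lborel. g s) \<partial>lborel) = (\<integral>s. (LINT t:{s<..}|lborel. k t) *\<^sub>R g s \<partial>lborel)"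
    unfolding 1 2 by (rule lborel_pair.Fubini_integral[OF F, symmetric])
qed

section \<open>The measure of the loop and uniqueness of weak derivatives\<close>

lemma integrable_loop_measure_iff:
  fixes f :: "real \<Rightarrow> 'b::{banach, second_countable_topology}"
  shows "integrable loop_measure f \<longleftrightarrow> integrable lborel (\<lambda>x. indicator {0<..<2 * pi} x *\<^sub>R f x)"
  unfolding loop_measure_def by (rule integrable_restrict_space) simp

lemma integral_loop_measure:
  fixes f :: "real \<Rightarrow> 'b::{banach, second_countable_topology}"
  shows "(\<integral>x. f x \<partial>loop_measure) = (\<integral>x. indicator {0<..<2 * pi} x *\<^sub>R f x \<partial>lborel)"
  unfolding loop_measure_def by (rule integral_restrict_space) simp

lemma AE_loop_measure: "(AE x in loop_measure. P x) \<longleftrightarrow> (AE x in lborel. x \<in> {0<..<2 * pi} \<longrightarrow> P x)"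
  unfolding loop_measure_def by (rule AE_restrict_space_iff) simp

lemma space_loop_measure [simp]: "space loop_measure = {0<..<2 * pi}"
  by (simp add: loop_measure_def space_restrict_space)

lemma finite_loop_measure: "finite_measure loop_measure"
  by (rule finite_measureI) (simp add: loop_measure_def emeasure_restrict_space space_restrict_space)

lemma measurable_loop_measure:
  "f \<in> borel_measurable borel \<Longrightarrow> f \<in> borel_measurable loop_measure"
  unfolding loop_measure_def by (rule measurable_restrict_space1) simp

text \<open>The loop has finite measure, so 1 plus the squared modulus is an integrable
  dominator.\<close>

lemma L2_integrable:
  assumes "f \<in> L2"
  shows "integrable loop_measure f"
proof (rule Bochner_Integration.integrable_bound)
  interpret finite_measure loop_measure by (rule finite_loop_measure)
  show "integrable loop_measure (\<lambda>x. 1 + (cmod (f x))\<^sup>2)"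
    using assms by (auto simp: L2_def)
  show "AE x in loop_measure. norm (f x) \<le> norm (1 + (cmod (f x))\<^sup>2)"
  proof (rule AE_I2)
    fix x
    have "0 \<le> (cmod (f x) - 1)\<^sup>2 + (cmod (f x))\<^sup>2 + 1" by simp
    then show "norm (f x) \<le> norm (1 + (cmod (f x))\<^sup>2)" by (simp add: power2_eq_square algebra_simps)
  qed
qed (use assms in \<open>auto simp: L2_def\<close>)

lemma bounded_imp_L2:
  assumes [measurable]: "f \<in> borel_measurable borel" and b: "\<And>x. x \<in> {0<..<2 * pi} \<Longrightarrow> cmod (f x) \<le> C"
  shows "f \<in> L2"
proof -
  interpret finite_measure loop_measure by (rule finite_loop_measure)
  have [measurable]: "f \<in> borel_measurable loop_measure" by (rule measurable_loop_measure) fact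
  have "integrable loop_measure (\<lambda>x. (cmod (f x))\<^sup>2)"
    by (rule integrable_const_bound[where B="C\<^sup>2"])
       (use b in \<open>auto intro!: AE_I2 power_mono\<close>)
  then show ?thesis by (simp add: L2_def)
qed

lemma has_L2_deriv_L2_deriv:
  assumes "has_L2_deriv \<psi> g"
  shows "has_L2_deriv \<psi> (L2_deriv \<psi>)"
  unfolding L2_deriv_def using assms by (rule someI[of "has_L2_deriv \<psi>"])

text \<open>Cutting \<open>g\<close> off outside the loop turns the integral into one over a
  half-line, the form in which the Dynkin and Fubini lemmas above are stated.\<close>

lemma has_L2_deriv_integral:
  assumes "has_L2_deriv \<psi> g" "x \<in> {0..2 * pi}"
  shows "\<psi> x = \<psi> 0 + (LINT t:{..<x}|lborel. indicator {0<..<2 * pi} t *\<^sub>R g t)"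
proof -
  have "(LINT t:{0<..<x}|lborel. g t) = (LINT t:{..<x}|lborel. indicator {0<..<2 * pi} t *\<^sub>R g t)"
    unfolding set_lebesgue_integral_def using assms(2)
    by (intro Bochner_Integration.integral_cong) (auto simp: indicator_def)
  then show ?thesis using assms unfolding has_L2_deriv_def by metis
qed

lemma has_L2_deriv_integrable:
  assumes "has_L2_deriv \<psi> g"
  shows "integrable lborel (\<lambda>t. indicator {0<..<2 * pi} t *\<^sub>R g t)"
  using assms L2_integrable by (auto simp: has_L2_deriv_def integrable_loop_measure_iff)

text \<open>\<open>L2_deriv\<close> picks a derivative by choice; this allows any explicit
  derivative to replace it under an integral.\<close>

lemma has_L2_deriv_unique:
  assumes g: "has_L2_deriv \<psi> g" and h: "has_L2_deriv \<psi> h"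
  shows "AE x in loop_measure. g x = h x"
proof -
  let ?I = "{0<..<2 * pi} :: real set"
  let ?f = "\<lambda>t. indicator ?I t *\<^sub>R g t - indicator ?I t *\<^sub>R h t"
  have G: "set_integrable lborel {..<x} (\<lambda>t. indicator ?I t *\<^sub>R g t)" for x
    unfolding set_integrable_def by (rule integrable_mult_indicator[OF _ has_L2_deriv_integrable[OF g]]) simp
  have H: "set_integrable lborel {..<x} (\<lambda>t. indicator ?I t *\<^sub>R h t)" for x
    unfolding set_integrable_def by (rule integrable_mult_indicator[OF _ has_L2_deriv_integrable[OF h]]) simp
  have "AE x in lborel. ?f x = 0"
  proof (rule AE_eq_0_if_integral_lessThan_eq_0)
    show "integrable lborel ?f"
      by (intro Bochner_Integration.integrable_diff has_L2_deriv_integrable[OF g] has_L2_deriv_integrable[OF h])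
    fix x :: real
    \<comment> \<open>The cut-off integrand vanishes outside the loop, so \<open>x\<close> may be
      clamped to the closed interval, where both primitives give the same increment of
      \<psi>.\<close>
    define y where "y = max 0 (min x (2 * pi))"
    have y: "y \<in> {0..2 * pi}" by (auto simp: y_def)
    have "(LINT t:{..<x}|lborel. ?f t) = (LINT t:{..<y}|lborel. ?f t)"
      unfolding set_lebesgue_integral_def
      by (intro Bochner_Integration.integral_cong) (auto simp: indicator_def y_def)
    also have "\<dots> = (LINT t:{..<y}|lborel. indicator ?I t *\<^sub>R g t) - (LINT t:{..<y}|lborel. indicator ?I t *\<^sub>R h t)"
      by (rule set_integral_diff(2)[OF G H])
    also have "\<dots> = 0"
      using has_L2_deriv_integral[OF g y] has_L2_deriv_integral[OF h y] by simp
    finally show "(LINT t:{..<x}|lborel. ?f t) = 0" .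
  qed
  then show ?thesis
    unfolding AE_loop_measure by eventually_elim (auto simp: indicator_def split: if_splits)
qed

section \<open>The Green function\<close>

text \<open>The periodic Green function of \<open>- d\<^sup>2/dx\<^sup>2 + \<kappa>\<^sup>2\<close>, as a function of the distance.\<close>

definition green :: "real \<Rightarrow> real \<Rightarrow> real" where
  "green \<kappa> d = cosh (\<kappa> * (pi - d)) / (2 * \<kappa> * sinh (\<kappa> * pi))"

definition kern :: "real \<Rightarrow> real \<Rightarrow> real \<Rightarrow> real" where
  "kern \<kappa> x t = green \<kappa> \<bar>t - x\<bar>"

text \<open>The derivative of \<open>kern\<close> in \<open>t\<close> away from \<open>x\<close>. It
  falls from 1/2 to -1/2 at \<open>x\<close>; this unit jump is the delta source of the Green
  function.\<close>

definition dkern :: "real \<Rightarrow> real \<Rightarrow> real \<Rightarrow> real" where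
  "dkern \<kappa> x t = (if t < x then 1 else -1) * sinh (\<kappa> * (pi - \<bar>t - x\<bar>)) / (2 * sinh (\<kappa> * pi))"

context
  fixes \<kappa> x :: real
  assumes \<kappa>: "\<kappa> > 0" and x: "x \<in> {0<..<2 * pi}"
begin

lemma sinh_pos: "sinh (\<kappa> * pi) > 0"
  using \<kappa> by simp

text \<open>Removing the jump of the derivative at \<open>x\<close> leaves a continuous function.\<close>

lemma dkern_plus_jump:
  "dkern \<kappa> x t + (if t < x then 0 else 1) =
    (sinh (\<kappa> * (pi - max (x - t) 0)) - sinh (\<kappa> * (pi - max (t - x) 0))) / (2 * sinh (\<kappa> * pi)) + 1/2"
  using sinh_pos by (auto simp: dkern_def max_def field_simps)

lemma continuous_on_kern: "continuous_on S (kern \<kappa> x)"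
  unfolding kern_def green_def using \<kappa> by (intro continuous_intros) auto

lemma continuous_on_dkern_plus_jump:
  "continuous_on S (\<lambda>t. dkern \<kappa> x t + (if t < x then 0 else 1))"
  unfolding dkern_plus_jump using \<kappa> by (intro continuous_intros) auto

lemma borel_measurable_kern: "kern \<kappa> x \<in> borel_measurable borel"
  by (rule borel_measurable_continuous_onI[OF continuous_on_kern])

lemma borel_measurable_dkern: "dkern \<kappa> x \<in> borel_measurable borel"
proof -
  have [measurable]: "(\<lambda>t. dkern \<kappa> x t + (if t < x then 0 else 1)) \<in> borel_measurable borel"
    by (rule borel_measurable_continuous_onI[OF continuous_on_dkern_plus_jump])
  have "(\<lambda>t. (dkern \<kappa> x t + (if t < x then 0 else 1)) - (if t < x then 0 else 1)) \<in> borel_measurable borel"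
    by measurable
  then show ?thesis by simp
qed

lemma abs_dkern_le:
  assumes "t \<in> {0..2 * pi}"
  shows "\<bar>dkern \<kappa> x t\<bar> \<le> 1 / 2"
proof -
  have "\<bar>\<kappa> * (pi - \<bar>t - x\<bar>)\<bar> \<le> \<kappa> * pi"
    using \<kappa> x assms by (auto simp: abs_mult)
  then have "\<bar>sinh (\<kappa> * (pi - \<bar>t - x\<bar>))\<bar> \<le> sinh (\<kappa> * pi)"
    by (simp add: abs_le_iff flip: sinh_minus)
  then show ?thesis
    using sinh_pos by (auto simp: dkern_def abs_mult abs_divide field_simps)
qed

text \<open>The equation u'' = \<kappa>^2 u away from \<open>x\<close>, as a first-order system
  whose second component carries a step that repairs the jump. In a ball around \<open>t\<close>
  that avoids \<open>x\<close>, each function agrees with a smooth expression.\<close>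

lemma kern_has_derivative:
  assumes "t \<noteq> x"
  shows "(kern \<kappa> x has_vector_derivative dkern \<kappa> x t) (at t)"
    and "((\<lambda>t. dkern \<kappa> x t + (if t < x then 0 else 1)) has_vector_derivative \<kappa>\<^sup>2 * kern \<kappa> x t) (at t)"
proof -
  note S = sinh_pos \<kappa>
  show "(kern \<kappa> x has_vector_derivative dkern \<kappa> x t) (at t)"
  proof (cases "t < x")
    case True
    have "((\<lambda>t. cosh (\<kappa> * (pi - (x - t))) / (2 * \<kappa> * sinh (\<kappa> * pi))) has_real_derivative dkern \<kappa> x t) (at t)"
      using True S by (auto intro!: derivative_eq_intros simp: dkern_def field_simps)
    then have "(kern \<kappa> x has_real_derivative dkern \<kappa> x t) (at t)"
      by (rule has_field_derivative_transform_within[where d="x - t"]) (use True in \<open>auto simp: kern_def green_def dist_real_def abs_if\<close>)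
    then show ?thesis by (simp add: has_real_derivative_iff_has_vector_derivative)
  next
    case False
    have "((\<lambda>t. cosh (\<kappa> * (pi - (t - x))) / (2 * \<kappa> * sinh (\<kappa> * pi))) has_real_derivative dkern \<kappa> x t) (at t)"
      using False S by (auto intro!: derivative_eq_intros simp: dkern_def field_simps)
    then have "(kern \<kappa> x has_real_derivative dkern \<kappa> x t) (at t)"
      by (rule has_field_derivative_transform_within[where d="t - x"]) (use False assms in \<open>auto simp: kern_def green_def dist_real_def abs_if\<close>)
    then show ?thesis by (simp add: has_real_derivative_iff_has_vector_derivative)
  qed
  show "((\<lambda>t. dkern \<kappa> x t + (if t < x then 0 else 1)) has_vector_derivative \<kappa>\<^sup>2 * kern \<kappa> x t) (at t)"
  proof (cases "t < x")
    case True
    have "((\<lambda>t. sinh (\<kappa> * (pi - (x - t))) / (2 * sinh (\<kappa> * pi))) has_real_derivative \<kappa>\<^sup>2 * kern \<kappa> x t) (at t)"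
      using True S by (auto intro!: derivative_eq_intros simp: kern_def green_def field_simps power2_eq_square)
    then have "((\<lambda>t. dkern \<kappa> x t + (if t < x then 0 else 1)) has_real_derivative \<kappa>\<^sup>2 * kern \<kappa> x t) (at t)"
      by (rule has_field_derivative_transform_within[where d="x - t"]) (use True in \<open>auto simp: dkern_def dist_real_def abs_if\<close>)
    then show ?thesis by (simp add: has_real_derivative_iff_has_vector_derivative)
  next
    case False
    have "((\<lambda>t. 1 - sinh (\<kappa> * (pi - (t - x))) / (2 * sinh (\<kappa> * pi))) has_real_derivative \<kappa>\<^sup>2 * kern \<kappa> x t) (at t)"
      using False S by (auto intro!: derivative_eq_intros simp: kern_def green_def field_simps power2_eq_square)
    then have "((\<lambda>t. dkern \<kappa> x t + (if t < x then 0 else 1)) has_real_derivative \<kappa>\<^sup>2 * kern \<kappa> x t) (at t)"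
      by (rule has_field_derivative_transform_within[where d="t - x"]) (use False assms in \<open>auto simp: dkern_def dist_real_def abs_if\<close>)
    then show ?thesis by (simp add: has_real_derivative_iff_has_vector_derivative)
  qed
qed

lemma set_integrable_dkern:
  assumes "t \<in> {0..2 * pi}"
  shows "set_integrable lborel {0..t} (dkern \<kappa> x)"
  unfolding set_integrable_def
proof (rule Bochner_Integration.integrable_bound)
  show "integrable lborel (\<lambda>s. indicator {0..t} s *\<^sub>R (1/2::real))"
    using assms by simp
  show "AE s in lborel. norm (indicat_real {0..t} s *\<^sub>R dkern \<kappa> x s) \<le> norm (indicator {0..t} s *\<^sub>R (1/2::real))"
    using abs_dkern_le assms by (intro AE_I2) (auto simp: indicator_def)
qed (use borel_measurable_dkern in measurable)

lemma integral_dkern: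
  assumes t: "t \<in> {0..2 * pi}"
  shows "(LINT s:{0<..<t}|lborel. dkern \<kappa> x s) = kern \<kappa> x t - kern \<kappa> x 0"
proof -
  have "(dkern \<kappa> x has_integral (kern \<kappa> x t - kern \<kappa> x 0)) {0..t}"
    using t by (intro fundamental_theorem_of_calculus_interior_strong[of "{x}"] continuous_on_kern kern_has_derivative(1)) auto
  then have "(LINT s:{0..t}|lborel. dkern \<kappa> x s) = kern \<kappa> x t - kern \<kappa> x 0"
    unfolding set_borel_integral_eq_integral(2)[OF set_integrable_dkern[OF t]] by (rule integral_unique)
  moreover have "(LINT s:{0<..<t}|lborel. dkern \<kappa> x s) = (LINT s:{0..t}|lborel. dkern \<kappa> x s)"
  proof (rule set_integral_cong_set)
    note borel_measurable_dkern [measurable]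
    show "set_borel_measurable lborel {0<..<t} (dkern \<kappa> x)" "set_borel_measurable lborel {0..t} (dkern \<kappa> x)"
      unfolding set_borel_measurable_def by measurable
    have "AE s in lborel. s \<noteq> 0 \<and> s \<noteq> t" by (intro AE_conjI AE_lborel_singleton)
    then show "AE s in lborel. s \<in> {0..t} \<longleftrightarrow> s \<in> {0<..<t}" by eventually_elim auto
  qed
  ultimately show ?thesis by simp
qed

text \<open>The fundamental theorem of calculus needs an antiderivative continuous across
  \<open>x\<close>; the step that repairs \<open>dkern\<close> there survives as the term with
  \<open>s < x\<close>.\<close>

lemma integral_kern:
  assumes s: "s \<in> {0..2 * pi}"
  shows "\<kappa>\<^sup>2 * (LINT t:{s<..}|lborel. indicator {0<..<2 * pi} t * kern \<kappa> x t) =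
      dkern \<kappa> x (2 * pi) - dkern \<kappa> x s + (if s < x then 1 else 0)"
proof -
  have int: "set_integrable lborel {s..2 * pi} (\<lambda>t. \<kappa>\<^sup>2 * kern \<kappa> x t)"
    by (intro borel_integrable_atLeastAtMost' continuous_intros continuous_on_kern)
  have "((\<lambda>t. \<kappa>\<^sup>2 * kern \<kappa> x t) has_integral ((dkern \<kappa> x (2 * pi) + (if 2 * pi < x then 0 else 1)) - (dkern \<kappa> x s + (if s < x then 0 else 1)))) {s..2 * pi}"
    using s by (intro fundamental_theorem_of_calculus_interior_strong[of "{x}"] continuous_on_dkern_plus_jump kern_has_derivative(2)) auto
  then have "(LINT t:{s..2 * pi}|lborel. \<kappa>\<^sup>2 * kern \<kappa> x t) = dkern \<kappa> x (2 * pi) - dkern \<kappa> x s + (if s < x then 1 else 0)"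
    unfolding set_borel_integral_eq_integral(2)[OF int] using x by (auto dest: integral_unique)
  moreover have "(LINT t:{s<..}|lborel. \<kappa>\<^sup>2 * (indicator {0<..<2 * pi} t * kern \<kappa> x t)) = (LINT t:{s..2 * pi}|lborel. \<kappa>\<^sup>2 * kern \<kappa> x t)"
    unfolding set_lebesgue_integral_def
  proof (rule integral_cong_AE)
    have "AE t in lborel. t \<noteq> s \<and> t \<noteq> 2 * pi" by (intro AE_conjI AE_lborel_singleton)
    then show "AE t in lborel. indicat_real {s<..} t *\<^sub>R (\<kappa>\<^sup>2 * (indicator {0<..<2 * pi} t * kern \<kappa> x t)) = indicat_real {s..2 * pi} t *\<^sub>R (\<kappa>\<^sup>2 * kern \<kappa> x t)"
      by eventually_elim (use s in \<open>auto simp: indicator_def\<close>)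
  qed (use borel_measurable_kern in measurable)
  ultimately show ?thesis by simp
qed

lemma kern_periodic: "kern \<kappa> x (2 * pi) = kern \<kappa> x 0" "dkern \<kappa> x (2 * pi) = dkern \<kappa> x 0"
proof -
  have *: "\<kappa> * (x - pi) = - (\<kappa> * (pi - x))" by (simp add: algebra_simps)
  show "kern \<kappa> x (2 * pi) = kern \<kappa> x 0" "dkern \<kappa> x (2 * pi) = dkern \<kappa> x 0"
    using x by (auto simp: kern_def green_def dkern_def * )
qed

text \<open>By Fubini, \<open>\<kappa>\<^sup>2 * kern\<close> is integrated against the primitive of \<open>g\<close>; its tail integral is
  \<open>- dkern\<close> up to a constant and the unit jump at \<open>x\<close>, and the jump produces the point value.\<close>

lemma kern_reproducing:
  assumes g: "has_L2_deriv \<phi> g" and per: "\<phi> 0 = \<phi> (2 * pi)"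
  shows "integrable loop_measure (\<lambda>t. kern \<kappa> x t *\<^sub>R \<phi> t)"
    and "integrable loop_measure (\<lambda>t. dkern \<kappa> x t *\<^sub>R g t)"
    and "(\<integral>t. dkern \<kappa> x t *\<^sub>R g t \<partial>loop_measure) + \<kappa>\<^sup>2 *\<^sub>R (\<integral>t. kern \<kappa> x t *\<^sub>R \<phi> t \<partial>loop_measure) = \<phi> x"
proof -
  note borel_measurable_dkern [measurable]
  let ?I = "{0<..<2 * pi} :: real set"
  define G where "G t = indicator ?I t *\<^sub>R g t" for t
  define k where "k t = indicator ?I t * kern \<kappa> x t" for t
  have G: "integrable lborel G"
    unfolding G_def by (rule has_L2_deriv_integrable[OF g])
  then have [measurable]: "G \<in> borel_measurable borel" by auto
  have "integrable lborel (\<lambda>t. indicator {0..2 * pi} t *\<^sub>R kern \<kappa> x t)"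
    using borel_integrable_atLeastAtMost'[OF continuous_on_kern[of "{0..2 * pi}"]] by (simp add: set_integrable_def)
  then have "integrable lborel (\<lambda>t. indicator ?I t *\<^sub>R (indicator {0..2 * pi} t *\<^sub>R kern \<kappa> x t))"
    by (rule integrable_mult_indicator[rotated]) simp
  also have "(\<lambda>t. indicator ?I t *\<^sub>R (indicator {0..2 * pi} t *\<^sub>R kern \<kappa> x t)) = k"
    by (auto simp: k_def indicator_def fun_eq_iff)
  finally have k: "integrable lborel k" .
  have k\<phi>: "indicator ?I t *\<^sub>R (kern \<kappa> x t *\<^sub>R \<phi> t) = k t *\<^sub>R \<phi> 0 + k t *\<^sub>R (LINT s:{..<t}|lborel. G s)" for t
    using has_L2_deriv_integral[OF g, of t] by (auto simp: k_def G_def[abs_def] indicator_def scaleR_add_right)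
  note F = integral_mult_primitive[OF G k]
  show 1: "integrable loop_measure (\<lambda>t. kern \<kappa> x t *\<^sub>R \<phi> t)"
    unfolding integrable_loop_measure_iff k\<phi> using k F(1) by (intro Bochner_Integration.integrable_add) auto
  have dG: "indicator ?I t *\<^sub>R (dkern \<kappa> x t *\<^sub>R g t) = dkern \<kappa> x t *\<^sub>R G t" for t
    by (simp add: G_def)
  have intdG: "integrable lborel (\<lambda>t. dkern \<kappa> x t *\<^sub>R G t)"
  proof (rule Bochner_Integration.integrable_bound[OF G])
    show "AE t in lborel. norm (dkern \<kappa> x t *\<^sub>R G t) \<le> norm (G t)"
    proof (rule AE_I2)
      fix t
      show "norm (dkern \<kappa> x t *\<^sub>R G t) \<le> norm (G t)"
        using abs_dkern_le[of t] mult_right_mono[of "\<bar>dkern \<kappa> x t\<bar>" 1 "norm (G t)"]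
        by (auto simp: G_def indicator_def)
    qed
  qed measurable
  show "integrable loop_measure (\<lambda>t. dkern \<kappa> x t *\<^sub>R g t)"
    unfolding integrable_loop_measure_iff dG by (rule intdG)
  \<comment> \<open>Periodicity means zero total increment, which removes the term with the constant
    \<open>dkern \<kappa> x (2 * pi)\<close> below.\<close>
  have G0: "(\<integral>t. G t \<partial>lborel) = 0"
  proof -
    have "(LINT t:{..<2 * pi}|lborel. G t) = (\<integral>t. G t \<partial>lborel)"
      unfolding set_lebesgue_integral_def
      by (intro Bochner_Integration.integral_cong) (auto simp: G_def indicator_def)
    then show ?thesis using has_L2_deriv_integral[OF g, of "2 * pi"] per by (simp add: G_def[abs_def])
  qed
  have Gx: "\<phi> x = \<phi> 0 + (\<integral>t. indicator {..<x} t *\<^sub>R G t \<partial>lborel)"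
    using has_L2_deriv_integral[OF g, of x] x by (simp add: G_def[abs_def] set_lebesgue_integral_def)
  \<comment> \<open>Since \<open>dkern\<close> agrees at both ends, only the unit jump remains.
    Hence the constant \<phi> 0 enters with coefficient exactly 1 and cancels at the end.\<close>
  have kint: "\<kappa>\<^sup>2 * (\<integral>t. k t \<partial>lborel) = 1"
  proof -
    have "(LINT t:{0<..}|lborel. k t) = (\<integral>t. k t \<partial>lborel)"
      unfolding set_lebesgue_integral_def
      by (intro Bochner_Integration.integral_cong) (auto simp: k_def indicator_def)
    then show ?thesis using integral_kern[of 0] x kern_periodic(2) by (simp add: k_def[abs_def])
  qed
  have ind: "integrable lborel (\<lambda>t. indicator {..<x} t *\<^sub>R G t)"
    by (rule integrable_mult_indicator[OF _ G]) simp
  have "\<kappa>\<^sup>2 *\<^sub>R (\<integral>t. k t *\<^sub>R (LINT s:{..<t}|lborel. G s) \<partial>lborel) =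
      (\<integral>s. \<kappa>\<^sup>2 *\<^sub>R ((LINT t:{s<..}|lborel. k t) *\<^sub>R G s) \<partial>lborel)"
    by (simp only: F(2) integral_scaleR_right)
  also have "\<dots> = (\<integral>s. dkern \<kappa> x (2 * pi) *\<^sub>R G s - dkern \<kappa> x s *\<^sub>R G s + indicator {..<x} s *\<^sub>R G s \<partial>lborel)"
  proof (rule Bochner_Integration.integral_cong[OF refl])
    fix s
    show "\<kappa>\<^sup>2 *\<^sub>R ((LINT t:{s<..}|lborel. k t) *\<^sub>R G s) = dkern \<kappa> x (2 * pi) *\<^sub>R G s - dkern \<kappa> x s *\<^sub>R G s + indicator {..<x} s *\<^sub>R G s"
    proof (cases "s \<in> ?I")
      case True
      have "\<kappa>\<^sup>2 *\<^sub>R ((LINT t:{s<..}|lborel. k t) *\<^sub>R G s) = (\<kappa>\<^sup>2 * (LINT t:{s<..}|lborel. k t)) *\<^sub>R G s" by simp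
      also have "\<kappa>\<^sup>2 * (LINT t:{s<..}|lborel. k t) = dkern \<kappa> x (2 * pi) - dkern \<kappa> x s + (if s < x then 1 else 0)"
        using integral_kern[of s] True by (simp add: k_def[abs_def])
      finally show ?thesis by (simp add: indicator_def algebra_simps)
    qed (simp add: G_def)
  qed
  also have "\<dots> = dkern \<kappa> x (2 * pi) *\<^sub>R (\<integral>s. G s \<partial>lborel) - (\<integral>s. dkern \<kappa> x s *\<^sub>R G s \<partial>lborel) + (\<integral>t. indicator {..<x} t *\<^sub>R G t \<partial>lborel)"
    using G intdG ind by (simp del: integral_indicator)
  also have "\<dots> = \<phi> x - \<phi> 0 - (\<integral>s. dkern \<kappa> x s *\<^sub>R G s \<partial>lborel)"
    unfolding G0 using Gx by simp
  finally have eq: "\<kappa>\<^sup>2 *\<^sub>R (\<integral>t. k t *\<^sub>R (LINT s:{..<t}|lborel. G s) \<partial>lborel) = \<phi> x - \<phi> 0 - (\<integral>s. dkern \<kappa> x s *\<^sub>R G s \<partial>lborel)" .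
  have "\<kappa>\<^sup>2 *\<^sub>R (\<integral>t. kern \<kappa> x t *\<^sub>R \<phi> t \<partial>loop_measure) =
      (\<kappa>\<^sup>2 * (\<integral>t. k t \<partial>lborel)) *\<^sub>R \<phi> 0 + \<kappa>\<^sup>2 *\<^sub>R (\<integral>t. k t *\<^sub>R (LINT s:{..<t}|lborel. G s) \<partial>lborel)"
    unfolding integral_loop_measure k\<phi> using k F(1)
    by (simp add: scaleR_add_right)
  then show "(\<integral>t. dkern \<kappa> x t *\<^sub>R g t \<partial>loop_measure) + \<kappa>\<^sup>2 *\<^sub>R (\<integral>t. kern \<kappa> x t *\<^sub>R \<phi> t \<partial>loop_measure) = \<phi> x"
    unfolding integral_loop_measure dG kint eq[unfolded integral_loop_measure] by simp
qed

end

section \<open>Superpositions of Green functions in the form domain\<close>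

lemma green_bounds:
  assumes "\<kappa> > 0" "d \<in> {0..2 * pi}"
  shows "0 \<le> green \<kappa> d" "green \<kappa> d \<le> green \<kappa> 0"
proof -
  have "cosh \<bar>\<kappa> * (pi - d)\<bar> \<le> cosh (\<kappa> * pi)"
    using assms by (subst cosh_real_nonneg_le_iff) (auto simp: abs_mult)
  then show "0 \<le> green \<kappa> d" "green \<kappa> d \<le> green \<kappa> 0"
    using assms by (auto simp: green_def divide_right_mono)
qed

lemma has_L2_deriv_kern_sum:
  assumes \<kappa>: "\<kappa> > 0" and Y: "Y \<subseteq> {0<..<2 * pi}"
  shows "has_L2_deriv (\<lambda>t. \<Sum>y\<in>Y. complex_of_real (a y * kern \<kappa> y t)) (\<lambda>t. \<Sum>y\<in>Y. complex_of_real (a y * dkern \<kappa> y t))"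
    (is "has_L2_deriv ?f ?g")
proof -
  have m: "?g \<in> borel_measurable borel"
  proof (intro borel_measurable_sum)
    fix y assume "y \<in> Y"
    then have [measurable]: "dkern \<kappa> y \<in> borel_measurable borel"
      using borel_measurable_dkern[OF \<kappa>] Y by blast
    show "(\<lambda>t. complex_of_real (a y * dkern \<kappa> y t)) \<in> borel_measurable borel" by measurable
  qed
  have "?g \<in> L2"
  proof (rule bounded_imp_L2[OF m])
    fix t :: real assume t: "t \<in> {0<..<2 * pi}"
    show "cmod (?g t) \<le> (\<Sum>y\<in>Y. \<bar>a y\<bar>)"
    proof (rule sum_norm_le)
      fix y assume "y \<in> Y"
      then have "\<bar>dkern \<kappa> y t\<bar> \<le> 1"
        using abs_dkern_le[OF \<kappa>, of y t] Y t by (auto simp: subset_iff)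
      then show "cmod (complex_of_real (a y * dkern \<kappa> y t)) \<le> \<bar>a y\<bar>"
        unfolding norm_of_real abs_mult by (intro mult_left_le) auto
    qed
  qed
  moreover have "?f t = ?f 0 + (LINT s:{0<..<t}|lborel. ?g s)" if t: "t \<in> {0..2 * pi}" for t
  proof -
    have int: "integrable lborel (\<lambda>s. complex_of_real (indicator {0<..<t} s * (a y * dkern \<kappa> y s)))" if "y \<in> Y" for y
    proof -
      have "set_integrable lborel {0..t} (dkern \<kappa> y)"
        using set_integrable_dkern[OF \<kappa> _ t] that Y by auto
      then have "set_integrable lborel {0<..<t} (dkern \<kappa> y)"
        by (rule set_integrable_subset) auto
      then have "integrable lborel (\<lambda>s. a y * (indicator {0<..<t} s * dkern \<kappa> y s))"
        by (simp add: set_integrable_def)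
      then show ?thesis
        unfolding complex_of_real_integrable_eq by (simp only: mult.left_commute)
    qed
    have "(LINT s:{0<..<t}|lborel. ?g s) = (\<integral>s. (\<Sum>y\<in>Y. complex_of_real (indicator {0<..<t} s * (a y * dkern \<kappa> y s))) \<partial>lborel)"
      unfolding set_lebesgue_integral_def
      by (intro Bochner_Integration.integral_cong) (auto simp: indicator_def)
    also have "\<dots> = (\<Sum>y\<in>Y. \<integral>s. complex_of_real (indicator {0<..<t} s * (a y * dkern \<kappa> y s)) \<partial>lborel)"
      by (intro Bochner_Integration.integral_sum int)
    also have "\<dots> = (\<Sum>y\<in>Y. complex_of_real (a y * (kern \<kappa> y t - kern \<kappa> y 0)))"
    proof (intro sum.cong refl)
      fix y assume y: "y \<in> Y"
      have "(\<integral>s. complex_of_real (indicator {0<..<t} s * (a y * dkern \<kappa> y s)) \<partial>lborel)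
          = complex_of_real (\<integral>s. a y * (indicator {0<..<t} s * dkern \<kappa> y s) \<partial>lborel)"
        unfolding integral_complex_of_real by (simp only: mult.left_commute)
      also have "\<dots> = complex_of_real (a y * (LINT s:{0<..<t}|lborel. dkern \<kappa> y s))"
        unfolding set_lebesgue_integral_def by simp
      also have "\<dots> = complex_of_real (a y * (kern \<kappa> y t - kern \<kappa> y 0))"
        using integral_dkern[OF \<kappa> _ t, of y] y Y by auto
      finally show "(\<integral>s. complex_of_real (indicator {0<..<t} s * (a y * dkern \<kappa> y s)) \<partial>lborel) = complex_of_real (a y * (kern \<kappa> y t - kern \<kappa> y 0))" .
    qed
    also have "\<dots> = ?f t - ?f 0"
      by (simp only: right_diff_distrib of_real_diff sum_subtractf)
    finally show ?thesis by simp
  qed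
  ultimately show ?thesis unfolding has_L2_deriv_def by blast
qed

lemma kern_sum_form_domain:
  assumes \<kappa>: "\<kappa> > 0" and Y: "Y \<subseteq> {0<..<2 * pi}"
  shows "(\<lambda>t. \<Sum>y\<in>Y. complex_of_real (a y * kern \<kappa> y t)) \<in> form_domain"
proof -
  have "(\<Sum>y\<in>Y. complex_of_real (a y * kern \<kappa> y 0)) = (\<Sum>y\<in>Y. complex_of_real (a y * kern \<kappa> y (2 * pi)))"
    by (intro sum.cong refl) (use kern_periodic(1)[OF \<kappa>] Y in auto)
  then show ?thesis
    using has_L2_deriv_kern_sum[OF assms, of a] by (auto simp: form_domain_def H1_def)
qed

section \<open>Reduction to a matrix\<close>

text \<open>The eigenfunction is the superposition of Green functions with weights \<open>a\<close>.
  By \<open>kern_reproducing\<close>, the derivative part of the form yields the weighted conjugate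
  point values of \<phi> minus \<kappa>^2 times the inner product. The eigenvector equation makes
  the point interactions cancel the point values.\<close>

lemma eigenfunction_of_eigenvector:
  assumes \<kappa>: "\<kappa> > 0" and Y: "Y \<subseteq> {0<..<2 * pi}"
    and eigen: "\<And>y. y \<in> Y \<Longrightarrow> - \<alpha> * (\<Sum>x\<in>Y. green \<kappa> \<bar>y - x\<bar> * a x) = a y"
    and nz: "\<exists>y\<in>Y. a y \<noteq> 0"
  shows "is_eigenvalue \<alpha> Y (- \<kappa>\<^sup>2)"
proof -
  define \<psi> where "\<psi> t = (\<Sum>y\<in>Y. complex_of_real (a y * kern \<kappa> y t))" for t
  define d\<psi> where "d\<psi> t = (\<Sum>y\<in>Y. complex_of_real (a y * dkern \<kappa> y t))" for t
  have deriv: "has_L2_deriv \<psi> d\<psi>" and dom: "\<psi> \<in> form_domain"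
    using has_L2_deriv_kern_sum[OF \<kappa> Y, of a] kern_sum_form_domain[OF \<kappa> Y, of a]
    by (simp_all add: \<psi>_def[abs_def] d\<psi>_def[abs_def])
  have at_Y: "complex_of_real \<alpha> * \<psi> y = - complex_of_real (a y)" if "y \<in> Y" for y
  proof -
    have "\<psi> y = complex_of_real (\<Sum>x\<in>Y. green \<kappa> \<bar>y - x\<bar> * a x)"
      by (simp add: \<psi>_def kern_def mult_ac)
    then have "complex_of_real \<alpha> * \<psi> y = complex_of_real (\<alpha> * (\<Sum>x\<in>Y. green \<kappa> \<bar>y - x\<bar> * a x))" by simp
    also have "\<alpha> * (\<Sum>x\<in>Y. green \<kappa> \<bar>y - x\<bar> * a x) = - a y" using eigen[OF that] by simp
    finally show ?thesis by simp
  qed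
  have cont: "continuous_on UNIV \<psi>"
    unfolding \<psi>_def[abs_def] by (intro continuous_intros continuous_on_kern[OF \<kappa>]) (use Y in auto)
  have [measurable]: "\<psi> \<in> borel_measurable borel" by (rule borel_measurable_continuous_onI[OF cont])
  have L2: "(\<lambda>x. complex_of_real (- \<kappa>\<^sup>2) * \<psi> x) \<in> L2"
  proof (rule bounded_imp_L2)
    fix t :: real assume t: "t \<in> {0<..<2 * pi}"
    have "cmod (\<psi> t) \<le> (\<Sum>y\<in>Y. \<bar>a y\<bar> * green \<kappa> 0)"
      unfolding \<psi>_def
    proof (rule sum_norm_le)
      fix y assume "y \<in> Y"
      then have "\<bar>t - y\<bar> \<in> {0..2 * pi}" using Y t by (auto simp: abs_le_iff)
      then have "\<bar>kern \<kappa> y t\<bar> \<le> green \<kappa> 0"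
        unfolding kern_def using green_bounds[OF \<kappa>] by (simp add: abs_of_nonneg)
      then show "cmod (complex_of_real (a y * kern \<kappa> y t)) \<le> \<bar>a y\<bar> * green \<kappa> 0"
        unfolding norm_of_real abs_mult by (rule mult_left_mono) simp
    qed
    then show "cmod (complex_of_real (- \<kappa>\<^sup>2) * \<psi> t) \<le> \<kappa>\<^sup>2 * (\<Sum>y\<in>Y. \<bar>a y\<bar> * green \<kappa> 0)"
      by (simp add: norm_mult norm_power mult_left_mono)
  qed simp
  have form: "form \<alpha> Y \<phi> \<psi> = L2_inner \<phi> (\<lambda>x. complex_of_real (- \<kappa>\<^sup>2) * \<psi> x)" if \<phi>: "\<phi> \<in> form_domain" for \<phi>
  proof -
    define g where "g = L2_deriv \<phi>"
    have g: "has_L2_deriv \<phi> g" and per: "\<phi> 0 = \<phi> (2 * pi)"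
      using \<phi> has_L2_deriv_L2_deriv by (auto simp: form_domain_def H1_def g_def)
    have R: "integrable loop_measure (\<lambda>t. kern \<kappa> y t *\<^sub>R \<phi> t)" "integrable loop_measure (\<lambda>t. dkern \<kappa> y t *\<^sub>R g t)"
       "(\<integral>t. dkern \<kappa> y t *\<^sub>R g t \<partial>loop_measure) = \<phi> y - \<kappa>\<^sup>2 *\<^sub>R (\<integral>t. kern \<kappa> y t *\<^sub>R \<phi> t \<partial>loop_measure)" if "y \<in> Y" for y
      using kern_reproducing[OF \<kappa> _ g per, of y] that Y by (auto simp: algebra_simps)
    \<comment> \<open>Used twice: for the derivative kernels paired with \<open>g\<close>, and for
      the kernels paired with \<phi>.\<close>
    have expand: "(\<integral>t. cnj (f t) * (\<Sum>y\<in>Y. complex_of_real (a y * h y t)) \<partial>loop_measure) =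
       (\<Sum>y\<in>Y. a y *\<^sub>R cnj (\<integral>t. h y t *\<^sub>R f t \<partial>loop_measure))"
      if "\<And>y. y \<in> Y \<Longrightarrow> integrable loop_measure (\<lambda>t. h y t *\<^sub>R f t)" for f :: "real \<Rightarrow> complex" and h
    proof -
      have "(\<integral>t. cnj (f t) * (\<Sum>y\<in>Y. complex_of_real (a y * h y t)) \<partial>loop_measure) =
          (\<integral>t. (\<Sum>y\<in>Y. a y *\<^sub>R cnj (h y t *\<^sub>R f t)) \<partial>loop_measure)"
        by (simp add: sum_distrib_left scaleR_conv_of_real mult_ac)
      also have "\<dots> = (\<Sum>y\<in>Y. \<integral>t. a y *\<^sub>R cnj (h y t *\<^sub>R f t) \<partial>loop_measure)"
        by (intro Bochner_Integration.integral_sum integrable_scaleR_right) (simp only: complex_integrable_cnj that)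
      also have "\<dots> = (\<Sum>y\<in>Y. a y *\<^sub>R cnj (\<integral>t. h y t *\<^sub>R f t \<partial>loop_measure))"
        by (simp only: integral_scaleR_right Bochner_Integration.integral_cnj)
      finally show ?thesis .
    qed
    have "L2_inner g (L2_deriv \<psi>) = (\<integral>t. cnj (g t) * d\<psi> t \<partial>loop_measure)"
      unfolding L2_inner_def
    proof (rule integral_cong_AE)
      have g_meas: "g \<in> borel_measurable loop_measure"
        using g unfolding has_L2_deriv_def L2_def by blast
      have d_meas: "f \<in> borel_measurable loop_measure" if "has_L2_deriv \<psi> f" for f
        using that unfolding has_L2_deriv_def L2_def by blast
      have "(\<lambda>x. cnj (g x)) \<in> borel_measurable loop_measure"
        by (rule measurable_compose[OF g_meas]) (intro borel_measurable_continuous_onI continuous_intros)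
      then show "(\<lambda>x. cnj (g x) * L2_deriv \<psi> x) \<in> borel_measurable loop_measure"
        "(\<lambda>t. cnj (g t) * d\<psi> t) \<in> borel_measurable loop_measure"
        by (rule borel_measurable_times[OF _ d_meas[OF has_L2_deriv_L2_deriv[OF deriv]]]
            borel_measurable_times[OF _ d_meas[OF deriv]])+
      show "AE x in loop_measure. cnj (g x) * L2_deriv \<psi> x = cnj (g x) * d\<psi> x"
        using has_L2_deriv_unique[OF has_L2_deriv_L2_deriv[OF deriv] deriv] by eventually_elim simp
    qed
    also have "\<dots> = (\<Sum>y\<in>Y. a y *\<^sub>R cnj (\<integral>t. dkern \<kappa> y t *\<^sub>R g t \<partial>loop_measure))"
      unfolding d\<psi>_def by (rule expand[OF R(2)])
    also have "\<dots> = (\<Sum>y\<in>Y. a y *\<^sub>R cnj (\<phi> y) - \<kappa>\<^sup>2 *\<^sub>R (a y *\<^sub>R cnj (\<integral>t. kern \<kappa> y t *\<^sub>R \<phi> t \<partial>loop_measure)))"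
      by (intro sum.cong refl) (simp add: R(3) scaleR_diff_right)
    also have "\<dots> = (\<Sum>y\<in>Y. a y *\<^sub>R cnj (\<phi> y)) - \<kappa>\<^sup>2 *\<^sub>R (\<Sum>y\<in>Y. a y *\<^sub>R cnj (\<integral>t. kern \<kappa> y t *\<^sub>R \<phi> t \<partial>loop_measure))"
      by (simp only: sum_subtractf scaleR_sum_right)
    also have "(\<Sum>y\<in>Y. a y *\<^sub>R cnj (\<integral>t. kern \<kappa> y t *\<^sub>R \<phi> t \<partial>loop_measure)) = (\<integral>t. cnj (\<phi> t) * \<psi> t \<partial>loop_measure)"
      unfolding \<psi>_def by (rule expand[OF R(1), symmetric])
    finally have 1: "L2_inner g (L2_deriv \<psi>) = (\<Sum>y\<in>Y. a y *\<^sub>R cnj (\<phi> y)) - \<kappa>\<^sup>2 *\<^sub>R (\<integral>t. cnj (\<phi> t) * \<psi> t \<partial>loop_measure)" .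
    have 2: "complex_of_real \<alpha> * (\<Sum>y\<in>Y. cnj (\<phi> y) * \<psi> y) = - (\<Sum>y\<in>Y. a y *\<^sub>R cnj (\<phi> y))"
    proof -
      have "complex_of_real \<alpha> * (cnj (\<phi> y) * \<psi> y) = - (a y *\<^sub>R cnj (\<phi> y))" if "y \<in> Y" for y
      proof -
        have "complex_of_real \<alpha> * (cnj (\<phi> y) * \<psi> y) = cnj (\<phi> y) * (complex_of_real \<alpha> * \<psi> y)"
          by (rule mult.left_commute)
        then show ?thesis unfolding at_Y[OF that] by (simp add: scaleR_conv_of_real)
      qed
      then show ?thesis by (simp add: sum_distrib_left sum_negf)
    qed
    have 3: "L2_inner \<phi> (\<lambda>x. complex_of_real (- \<kappa>\<^sup>2) * \<psi> x) = (\<integral>t. complex_of_real (- \<kappa>\<^sup>2) * (cnj (\<phi> t) * \<psi> t) \<partial>loop_measure)"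
      unfolding L2_inner_def by (rule Bochner_Integration.integral_cong) (simp_all add: mult.left_commute)
    have "L2_inner \<phi> (\<lambda>x. complex_of_real (- \<kappa>\<^sup>2) * \<psi> x) = - (\<kappa>\<^sup>2 *\<^sub>R (\<integral>t. cnj (\<phi> t) * \<psi> t \<partial>loop_measure))"
      unfolding 3 integral_mult_right_zero by (simp add: scaleR_conv_of_real)
    then show ?thesis
      unfolding form_def g_def[symmetric] 1 2 by simp
  qed
  \<comment> \<open>The zero set is closed; if it had full measure in the open interval it would
    contain all of \<open>Y\<close>, although \<alpha> times the value at \<open>y\<close> is
    \<open>- a y\<close>, which is nonzero somewhere.\<close>
  have "\<not> (AE x in loop_measure. \<psi> x = 0)"
  proof
    assume "AE x in loop_measure. \<psi> x = 0"
    then have "AE x\<in>{0<..<2 * pi} in lborel. x \<in> \<psi> -` {0}"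
      unfolding AE_loop_measure by simp
    then have ae: "AE x\<in>{0<..<2 * pi} in lebesgue. x \<in> \<psi> -` {0}"
      by (rule AE_completion)
    have closed: "closed (\<psi> -` {0})"
      using continuous_closed_vimage[of "{0}" \<psi>] cont by (simp add: continuous_on_eq_continuous_at)
    from nz obtain y where y: "y \<in> Y" "a y \<noteq> 0" by blast
    have "y \<in> {0<..<2 * pi}" using y(1) Y by blast
    then have "y \<in> \<psi> -` {0}"
      by (rule mem_closed_if_AE_lebesgue_open[OF open_greaterThanLessThan closed ae])
    then show False using at_Y[OF y(1)] y(2) by simp
  qed
  moreover have "(\<psi>, \<lambda>x. complex_of_real (- \<kappa>\<^sup>2) * \<psi> x) \<in> H_graph \<alpha> Y"
    unfolding H_graph_def mem_Collect_eq case_prod_conv using dom L2 form by blast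
  ultimately show ?thesis
    unfolding is_eigenvalue_def by blast
qed

text \<open>Testing the eigenvalue equation with the Green function centred at \<open>x\<close>
  expresses the value of the eigenfunction at \<open>x\<close> through its values on
  \<open>Y\<close>. Restricting \<open>x\<close> to \<open>Y\<close> gives the matrix
  equation.\<close>

lemma eigenvector_of_eigenvalue:
  assumes \<kappa>: "\<kappa> > 0" and Y: "Y \<subseteq> {0<..<2 * pi}" and "is_eigenvalue \<alpha> Y (- \<kappa>\<^sup>2)"
  obtains a where "\<And>y. y \<in> Y \<Longrightarrow> - \<alpha> * (\<Sum>x\<in>Y. green \<kappa> \<bar>y - x\<bar> * a x) = a y" "\<exists>y\<in>Y. a y \<noteq> 0"
proof -
  obtain \<psi> where dom: "\<psi> \<in> form_domain"
    and form: "\<And>\<phi>. \<phi> \<in> form_domain \<Longrightarrow> form \<alpha> Y \<phi> \<psi> = L2_inner \<phi> (\<lambda>x. complex_of_real (- \<kappa>\<^sup>2) * \<psi> x)"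
    and nz: "\<not> (AE x in loop_measure. \<psi> x = 0)"
    using assms(3) unfolding is_eigenvalue_def H_graph_def mem_Collect_eq case_prod_conv by blast
  define g where "g = L2_deriv \<psi>"
  have g: "has_L2_deriv \<psi> g" and per: "\<psi> 0 = \<psi> (2 * pi)"
    using dom has_L2_deriv_L2_deriv by (auto simp: form_domain_def H1_def g_def)
  \<comment> \<open>Stated for every interior point, not only on \<open>Y\<close>, so that an
    eigenfunction vanishing on \<open>Y\<close> vanishes throughout.\<close>
  have repr: "\<psi> x = - \<alpha> *\<^sub>R (\<Sum>y\<in>Y. green \<kappa> \<bar>x - y\<bar> *\<^sub>R \<psi> y)" if x: "x \<in> {0<..<2 * pi}" for x
  proof -
    define k where "k t = complex_of_real (kern \<kappa> x t)" for t
    have k: "has_L2_deriv k (\<lambda>t. complex_of_real (dkern \<kappa> x t))" "k \<in> form_domain"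
      using has_L2_deriv_kern_sum[OF \<kappa>, of "{x}" "\<lambda>_. 1"] kern_sum_form_domain[OF \<kappa>, of "{x}" "\<lambda>_. 1"] x
      by (simp_all add: k_def[abs_def])
    have "L2_inner (L2_deriv k) g = (\<integral>t. dkern \<kappa> x t *\<^sub>R g t \<partial>loop_measure)"
      unfolding L2_inner_def
    proof (rule integral_cong_AE)
      have Dg: "g \<in> borel_measurable loop_measure" and Dk: "L2_deriv k \<in> borel_measurable loop_measure"
        using g has_L2_deriv_L2_deriv[OF k(1)] unfolding has_L2_deriv_def L2_def by blast+
      have "(\<lambda>t. cnj (L2_deriv k t)) \<in> borel_measurable loop_measure"
        by (rule measurable_compose[OF Dk]) (intro borel_measurable_continuous_onI continuous_intros)
      then show "(\<lambda>t. cnj (L2_deriv k t) * g t) \<in> borel_measurable loop_measure"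
        by (rule borel_measurable_times[OF _ Dg])
      show "(\<lambda>t. dkern \<kappa> x t *\<^sub>R g t) \<in> borel_measurable loop_measure"
        by (intro borel_measurable_scaleR Dg measurable_loop_measure borel_measurable_dkern[OF \<kappa> x])
      show "AE t in loop_measure. cnj (L2_deriv k t) * g t = dkern \<kappa> x t *\<^sub>R g t"
        using has_L2_deriv_unique[OF has_L2_deriv_L2_deriv[OF k(1)] k(1)]
        by eventually_elim (simp add: scaleR_conv_of_real)
    qed
    also have "\<dots> = \<psi> x - \<kappa>\<^sup>2 *\<^sub>R (\<integral>t. kern \<kappa> x t *\<^sub>R \<psi> t \<partial>loop_measure)"
      using kern_reproducing(3)[OF \<kappa> x g per] by (simp add: algebra_simps)
    finally have 1: "L2_inner (L2_deriv k) g = \<psi> x - \<kappa>\<^sup>2 *\<^sub>R (\<integral>t. kern \<kappa> x t *\<^sub>R \<psi> t \<partial>loop_measure)" .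
    have 2: "L2_inner k (\<lambda>x. complex_of_real (- \<kappa>\<^sup>2) * \<psi> x) = (\<integral>t. complex_of_real (- \<kappa>\<^sup>2) * (kern \<kappa> x t *\<^sub>R \<psi> t) \<partial>loop_measure)"
      unfolding L2_inner_def by (simp add: k_def scaleR_conv_of_real mult.left_commute)
    have 3: "L2_inner k (\<lambda>x. complex_of_real (- \<kappa>\<^sup>2) * \<psi> x) = - (\<kappa>\<^sup>2 *\<^sub>R (\<integral>t. kern \<kappa> x t *\<^sub>R \<psi> t \<partial>loop_measure))"
      unfolding 2 integral_mult_right_zero by (simp add: scaleR_conv_of_real)
    have 4: "form \<alpha> Y k \<psi> = L2_inner (L2_deriv k) g + \<alpha> *\<^sub>R (\<Sum>y\<in>Y. green \<kappa> \<bar>x - y\<bar> *\<^sub>R \<psi> y)"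
      unfolding form_def g_def k_def[abs_def] by (simp add: kern_def scaleR_conv_of_real abs_minus_commute[of x])
    show ?thesis
    proof -
      have "\<psi> x + \<alpha> *\<^sub>R (\<Sum>y\<in>Y. green \<kappa> \<bar>x - y\<bar> *\<^sub>R \<psi> y) = 0"
        using form[OF k(2)] unfolding 1 3 4 by (simp add: eq_neg_iff_add_eq_0)
      then show ?thesis by (simp add: eq_neg_iff_add_eq_0)
    qed
  qed
  have re: "- \<alpha> * (\<Sum>x\<in>Y. green \<kappa> \<bar>y - x\<bar> * Re (\<psi> x)) = Re (\<psi> y)"
   and im: "- \<alpha> * (\<Sum>x\<in>Y. green \<kappa> \<bar>y - x\<bar> * Im (\<psi> x)) = Im (\<psi> y)" if "y \<in> Y" for y
  proof -
    have y: "y \<in> {0<..<2 * pi}" using that Y by blast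
    show "- \<alpha> * (\<Sum>x\<in>Y. green \<kappa> \<bar>y - x\<bar> * Re (\<psi> x)) = Re (\<psi> y)"
      unfolding arg_cong[OF repr[OF y], of Re] by simp
    show "- \<alpha> * (\<Sum>x\<in>Y. green \<kappa> \<bar>y - x\<bar> * Im (\<psi> x)) = Im (\<psi> y)"
      unfolding arg_cong[OF repr[OF y], of Im] by simp
  qed
  have "\<exists>y\<in>Y. \<psi> y \<noteq> 0"
  proof (rule ccontr)
    assume "\<not> (\<exists>y\<in>Y. \<psi> y \<noteq> 0)"
    then have "\<psi> x = 0" if "x \<in> {0<..<2 * pi}" for x
      using repr[OF that] by simp
    then have "AE x in loop_measure. \<psi> x = 0" by (intro AE_I2) simp
    then show False using nz by simp
  qed
  then obtain y where y: "y \<in> Y" "\<psi> y \<noteq> 0" by blast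
  \<comment> \<open>The matrix and \<alpha> are real, so the real and the imaginary parts both solve
    the equation, and one of them is nonzero at \<open>y\<close>.\<close>
  show thesis
  proof (cases "Re (\<psi> y) = 0")
    case True
    then have "Im (\<psi> y) \<noteq> 0" using y(2) by (simp add: complex_eq_iff)
    then show thesis using y(1) im by (intro that[of "\<lambda>x. Im (\<psi> x)"]) blast+
  next
    case False
    then show thesis using y(1) re by (intro that[of "\<lambda>x. Re (\<psi> x)"]) blast+
  qed
qed

section \<open>Cyclic sums and convexity\<close>

text \<open>The average of the tangent inequalities for exp at \<open>c\<close> and
  \<open>- c\<close>; strictness of one of them suffices.\<close>

lemma cosh_ge_tangent:
  fixes u c :: real
  shows "cosh u \<ge> cosh c + (u - c) * sinh c"
    and "u \<noteq> c \<Longrightarrow> cosh u > cosh c + (u - c) * sinh c"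
proof -
  have ge: "exp c + (u - c) * exp c \<le> exp u" for u c :: real
    using mult_left_mono[OF exp_ge_add_one_self[of "u - c"], of "exp c"]
    by (simp add: algebra_simps flip: exp_add)
  have gt: "exp c + (u - c) * exp c < exp u" if "u \<noteq> c"
  proof -
    have "1 + (u - c) < exp (u - c)"
      using that exp_minus_greater[of "c - u"] by simp
    from mult_strict_left_mono[OF this, of "exp c"] show ?thesis
      by (simp add: algebra_simps flip: exp_add)
  qed
  show "cosh u \<ge> cosh c + (u - c) * sinh c"
    using ge[of c u] ge[of "- c" "- u"] by (simp add: cosh_field_def sinh_field_def field_simps)
  show "cosh u > cosh c + (u - c) * sinh c" if "u \<noteq> c"
    using gt[OF that] ge[of "- c" "- u"] by (simp add: cosh_field_def sinh_field_def field_simps)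
qed

text \<open>On the fundamental domain a rotation must be wrapped at the ends, and the bound on
  \<open>c\<close> makes one wrap enough. Points of \<open>Y\<close> are not wrapped because their
  translates already lie in \<open>loop\<close>.\<close>

lemma congruent_rotation:
  assumes Y: "Y \<subseteq> loop" and c: "\<bar>c\<bar> < 2 * pi" and Z: "(\<lambda>y. y + c) ` Y = Z" "Z \<subseteq> loop"
  shows "congruent_sets Y Z"
proof -
  define rot where "rot c x = (if x + c < 0 then x + c + 2 * pi else if x + c \<ge> 2 * pi then x + c - 2 * pi else x + c)" for c x :: real
  have loop: "rot c x \<in> loop" if "x \<in> loop" "\<bar>c\<bar> < 2 * pi" for c x
    using that by (auto simp: rot_def loop_def)
  have inv: "rot (- c) (rot c x) = x" if "x \<in> loop" for c x
    using that by (auto simp: rot_def loop_def)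
  have "bij_betw (rot c) loop loop"
    using loop[of _ c] loop[of _ "- c"] inv[of _ c] inv[of _ "- c"] c
    by (intro bij_betw_byWitness[where f'="rot (- c)"]) auto
  moreover have "arc_dist (rot c x) (rot c y) = arc_dist x y" if "x \<in> loop" "y \<in> loop" for x y
    using that c unfolding rot_def loop_def arc_dist_def by (simp add: min_def abs_if)
  moreover have "rot c ` Y = Z"
  proof -
    have "rot c y = y + c" if "y \<in> Y" for y
    proof -
      have "y + c \<in> Z" using that Z(1) by blast
      then show ?thesis using Z(2) by (auto simp: rot_def loop_def)
    qed
    then show ?thesis using Z(1) by force
  qed
  ultimately show ?thesis unfolding congruent_sets_def loop_isometry_def by blast
qed

text \<open>Continuing the increasing enumeration past \<open>N\<close>, one turn of the loop at a
  time, lets cyclic neighbours be written \<open>y (i + k)\<close> without reducing indices.\<close>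

lemma periodic_enumeration:
  assumes "finite Y" "card Y = N" "N > 0"
  obtains y :: "nat \<Rightarrow> real" where "\<And>i j. i \<le> j \<Longrightarrow> j < N \<Longrightarrow> y i \<le> y j" "bij_betw y {..<N} Y"
    "\<And>i. y (i + N) = y i + 2 * pi"
proof -
  define L where "L = sorted_list_of_set Y"
  have L: "length L = N" "sorted L" "distinct L" "set L = Y"
    using assms by (auto simp: L_def)
  define y where "y i = L ! (i mod N) + 2 * pi * real (i div N)" for i
  have y: "y i = L ! i" if "i < N" for i using that by (simp add: y_def)
  show thesis
  proof (rule that[of y])
    show "y i \<le> y j" if "i \<le> j" "j < N" for i j
      using that L by (simp add: y sorted_nth_mono)
    have "bij_betw ((!) L) {..<N} Y"
      using bij_betw_nth[OF L(3), of "{..<N}" Y] L by simp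
    then show "bij_betw y {..<N} Y"
      by (rule bij_betw_cong[THEN iffD1, rotated]) (simp add: y)
    show "y (i + N) = y i + 2 * pi" for i
      using assms by (simp add: y_def algebra_simps)
  qed
qed

text \<open>Offsets below \<open>N - i\<close> stay within the first turn. The others wrap around
  and measure the complementary arc, which the symmetry of \<open>h\<close> identifies with the
  direct distance.\<close>

lemma cyclic_row_sum:
  fixes y :: "nat \<Rightarrow> real"
  assumes mono: "\<And>i j. i \<le> j \<Longrightarrow> j < N \<Longrightarrow> y i \<le> y j"
    and per: "\<And>i. y (i + N) = y i + 2 * pi"
    and h: "\<And>d. h (2 * pi - d) = h d" and i: "i < N"
  shows "(\<Sum>j<N. h \<bar>y i - y j\<bar>) = (\<Sum>k<N. h (y (i + k) - y i))"
proof -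
  have "(\<Sum>k<N. h (y (i + k) - y i)) = (\<Sum>k\<in>{..<N - i}. h (y (i + k) - y i)) + (\<Sum>k\<in>{N - i..<N}. h (y (i + k) - y i))"
    by (subst sum.union_disjoint[symmetric]) (auto intro!: sum.cong)
  also have "(\<Sum>k\<in>{..<N - i}. h (y (i + k) - y i)) = (\<Sum>j\<in>{i..<N}. h \<bar>y i - y j\<bar>)"
  proof (rule sum.reindex_bij_witness[of _ "\<lambda>j. j - i" "\<lambda>k. i + k"])
    fix k assume "k \<in> {..<N - i}"
    then have "y i \<le> y (i + k)" by (intro mono) auto
    then show "h \<bar>y i - y (i + k)\<bar> = h (y (i + k) - y i)" by simp
  qed auto
  also have "(\<Sum>k\<in>{N - i..<N}. h (y (i + k) - y i)) = (\<Sum>j\<in>{..<i}. h \<bar>y i - y j\<bar>)"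
  proof (rule sum.reindex_bij_witness[of _ "\<lambda>j. j + N - i" "\<lambda>k. i + k - N"])
    fix k assume k: "k \<in> {N - i..<N}"
    define j where "j = i + k - N"
    have j: "i + k = j + N" "j \<le> i" using k i by (auto simp: j_def)
    have "h (y (i + k) - y i) = h (2 * pi - (y i - y j))" unfolding j(1) per by (simp add: algebra_simps)
    also have "\<dots> = h \<bar>y i - y j\<bar>" using mono[OF j(2) i] by (simp add: h)
    finally show "h \<bar>y i - y (i + k - N)\<bar> = h (y (i + k) - y i)" by (simp add: j_def)
  qed (use i in auto)
  also have "(\<Sum>j\<in>{i..<N}. h \<bar>y i - y j\<bar>) + (\<Sum>j\<in>{..<i}. h \<bar>y i - y j\<bar>) = (\<Sum>j<N. h \<bar>y i - y j\<bar>)"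
    using i by (subst sum.union_disjoint[symmetric]) (auto intro!: sum.cong)
  finally show ?thesis by simp
qed

text \<open>Raising the offset by one adds all gaps of one full turn, a telescoping sum of value 2
  pi.\<close>

lemma sum_cyclic_differences:
  fixes y :: "nat \<Rightarrow> real"
  assumes per: "\<And>i. y (i + N) = y i + 2 * pi"
  shows "(\<Sum>i<N. y (i + k) - y i) = 2 * pi * real k"
proof (induction k)
  case (Suc k)
  have "(\<Sum>i<N. y (i + Suc k) - y i) = (\<Sum>i<N. y (Suc i + k) - y (i + k)) + (\<Sum>i<N. y (i + k) - y i)"
    by (simp flip: sum.distrib)
  also have "(\<Sum>i<N. y (Suc i + k) - y (i + k)) = y (k + N) - y k"
    using sum_lessThan_telescope[of "\<lambda>i. y (i + k)" N] by (simp add: add.commute)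
  also have "\<dots> = 2 * pi" by (simp add: per)
  finally show ?case by (simp add: Suc.IH algebra_simps)
qed simp

section \<open>Convexity of the Green function at a fixed cyclic offset\<close>

lemma green_symmetric: "green \<kappa> (2 * pi - d) = green \<kappa> d"
proof -
  have "\<kappa> * (pi - (2 * pi - d)) = - (\<kappa> * (pi - d))" by (simp add: algebra_simps)
  then show ?thesis by (simp add: green_def)
qed

text \<open>The tangent inequality for cosh at \<kappa> (pi - e), evaluated at \<kappa> (pi - d) and
  divided by the positive denominator of \<open>green\<close>.\<close>

lemma green_tangent:
  assumes "\<kappa> > 0"
  shows "green \<kappa> d \<ge> green \<kappa> e + (e - d) * (sinh (\<kappa> * (pi - e)) / (2 * sinh (\<kappa> * pi)))"
    and "d \<noteq> e \<Longrightarrow> green \<kappa> d > green \<kappa> e + (e - d) * (sinh (\<kappa> * (pi - e)) / (2 * sinh (\<kappa> * pi)))"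
proof -
  let ?c = "\<kappa> * (pi - e)" and ?u = "\<kappa> * (pi - d)"
  have D: "2 * \<kappa> * sinh (\<kappa> * pi) > 0" using assms by simp
  have "sinh (\<kappa> * pi) > 0" using assms by simp
  then have "green \<kappa> e + (e - d) * (sinh (\<kappa> * (pi - e)) / (2 * sinh (\<kappa> * pi)))
      = (cosh ?c + (?u - ?c) * sinh ?c) / (2 * \<kappa> * sinh (\<kappa> * pi))"
    using assms by (simp add: green_def field_simps)
  then show "green \<kappa> d \<ge> green \<kappa> e + (e - d) * (sinh (\<kappa> * (pi - e)) / (2 * sinh (\<kappa> * pi)))"
    "d \<noteq> e \<Longrightarrow> green \<kappa> d > green \<kappa> e + (e - d) * (sinh (\<kappa> * (pi - e)) / (2 * sinh (\<kappa> * pi)))"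
    using cosh_ge_tangent[where u="?u" and c="?c"] D assms
    by (auto simp: green_def[of _ d] divide_right_mono divide_strict_right_mono)
qed

text \<open>Jensen's inequality by the tangent at the mean distance: the linear terms add up to zero
  by \<open>sum_cyclic_differences\<close>, and one distance off the mean makes its tangent
  inequality strict.\<close>

lemma green_cyclic_sum:
  fixes y :: "nat \<Rightarrow> real"
  assumes \<kappa>: "\<kappa> > 0" and N: "N > 0" and per: "\<And>i. y (i + N) = y i + 2 * pi"
  shows "(\<Sum>i<N. green \<kappa> (y (i + k) - y i)) \<ge> real N * green \<kappa> (2 * pi * real k / real N)"
    and "i < N \<Longrightarrow> y (i + k) - y i \<noteq> 2 * pi * real k / real N \<Longrightarrow>
      (\<Sum>i<N. green \<kappa> (y (i + k) - y i)) > real N * green \<kappa> (2 * pi * real k / real N)"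
proof -
  define e where "e = 2 * pi * real k / real N"
  define s where "s = sinh (\<kappa> * (pi - e)) / (2 * sinh (\<kappa> * pi))"
  have "(\<Sum>i<N. green \<kappa> e + (e - (y (i + k) - y i)) * s) = real N * green \<kappa> e + (\<Sum>i<N. e - (y (i + k) - y i)) * s"
    by (simp add: sum.distrib flip: sum_distrib_right)
  also have "(\<Sum>i<N. e - (y (i + k) - y i)) = real N * e - (\<Sum>i<N. y (i + k) - y i)"
    by (simp add: sum_subtractf)
  also have "\<dots> = 0" unfolding sum_cyclic_differences[where y=y and N=N, OF per] using N by (simp add: e_def)
  finally have eq: "(\<Sum>i<N. green \<kappa> e + (e - (y (i + k) - y i)) * s) = real N * green \<kappa> e" by simp
  show "(\<Sum>i<N. green \<kappa> (y (i + k) - y i)) \<ge> real N * green \<kappa> (2 * pi * real k / real N)"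
    unfolding e_def[symmetric] eq[symmetric] s_def by (intro sum_mono green_tangent(1)[OF \<kappa>])
  show "(\<Sum>i<N. green \<kappa> (y (i + k) - y i)) > real N * green \<kappa> (2 * pi * real k / real N)"
    if "i < N" "y (i + k) - y i \<noteq> 2 * pi * real k / real N"
    unfolding e_def[symmetric] eq[symmetric] s_def
  proof (rule sum_strict_mono_ex1)
    show "\<exists>i\<in>{..<N}. green \<kappa> e + (e - (y (i + k) - y i)) * (sinh (\<kappa> * (pi - e)) / (2 * sinh (\<kappa> * pi)))
        < green \<kappa> (y (i + k) - y i)"
      using that by (intro bexI[of _ i] green_tangent(2)[OF \<kappa>]) (simp_all add: e_def)
  qed (simp, intro ballI green_tangent(1)[OF \<kappa>])
qed

section \<open>Energy of the vector of ones and of the equidistant set\<close>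

abbreviation energy :: "real \<Rightarrow> real set \<Rightarrow> (real \<Rightarrow> real) \<Rightarrow> real" where
  "energy \<kappa> \<equiv> quad (\<lambda>x y. green \<kappa> \<bar>x - y\<bar>)"

text \<open>The common row sum of the Green matrix of equidistant points. It bounds the Rayleigh
  quotient from above for that set, and from below at the vector of ones for a non-congruent
  set.\<close>

definition mean_green :: "nat \<Rightarrow> real \<Rightarrow> real" where
  "mean_green N \<kappa> = (\<Sum>k<N. green \<kappa> (2 * pi * real k / real N))"

lemma Y_tilde_eq: "Y_tilde N = (\<lambda>i. pi / real N * (2 * real i + 1)) ` {..<N}"
proof -
  have 1: "{1..N} = Suc ` {..<N}"
    by (simp add: lessThan_atLeast0 image_Suc_atLeastLessThan atLeastLessThanSuc_atLeastAtMost)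
  have 2: "2 * real (Suc i) - 1 = 2 * real i + 1" for i by simp
  show ?thesis unfolding Y_tilde_def 1 image_image 2 ..
qed

lemma Y_tilde_subset: "Y_tilde N \<subseteq> {0<..<2 * pi}"
proof -
  have "pi / real N * (2 * real i + 1) \<in> {0<..<2 * pi}" if "i < N" for i
  proof -
    have "2 * real i + 1 < 2 * real N" using that by linarith
    from mult_strict_left_mono[OF this pi_gt_zero]
    have "pi / real N * (2 * real i + 1) < 2 * pi" using that by (simp add: field_simps)
    moreover have "0 < pi / real N * (2 * real i + 1)"
      using that by (intro mult_pos_pos divide_pos_pos) auto
    ultimately show ?thesis by simp
  qed
  then show ?thesis unfolding Y_tilde_eq by auto
qed

lemma energy_one_gt:
  assumes \<kappa>: "\<kappa> > 0" and N: "N \<ge> 2" and Y: "Y \<subseteq> {0<..<2 * pi}" "finite Y" "card Y = N"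
    and nc: "\<not> congruent_sets Y (Y_tilde N)"
  shows "energy \<kappa> Y (\<lambda>_. 1) > real N * mean_green N \<kappa>"
proof -
  from N have N0: "N > 0" by simp
  obtain y :: "nat \<Rightarrow> real" where mono: "\<And>i j. i \<le> j \<Longrightarrow> j < N \<Longrightarrow> y i \<le> y j"
    and bij: "bij_betw y {..<N} Y" and per: "\<And>i. y (i + N) = y i + 2 * pi"
    using periodic_enumeration[OF Y(2,3) N0] by metis
  have sumY: "(\<Sum>x\<in>Y. f x) = (\<Sum>i<N. f (y i))" for f :: "real \<Rightarrow> real"
    by (rule sum.reindex_bij_betw[OF bij, symmetric])
  have "energy \<kappa> Y (\<lambda>_. 1) = (\<Sum>i<N. \<Sum>j<N. green \<kappa> \<bar>y i - y j\<bar>)"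
    by (simp add: quad_def sumY)
  also have "\<dots> = (\<Sum>i<N. \<Sum>k<N. green \<kappa> (y (i + k) - y i))"
    by (intro sum.cong refl cyclic_row_sum mono per green_symmetric) auto
  also have "\<dots> = (\<Sum>k<N. \<Sum>i<N. green \<kappa> (y (i + k) - y i))" by (rule sum.swap)
  finally have e: "energy \<kappa> Y (\<lambda>_. 1) = (\<Sum>k<N. \<Sum>i<N. green \<kappa> (y (i + k) - y i))" .
  \<comment> \<open>Strictness is sought at offset 1, which occurs because \<open>N\<close> is at
    least 2: if all cyclic gaps were equal, \<open>Y\<close> would be a rotated copy of the
    equidistant set.\<close>
  have "\<exists>i<N. y (i + 1) - y i \<noteq> 2 * pi * real 1 / real N"
  proof (rule ccontr)
    assume "\<not> ?thesis"
    then have step: "y (Suc i) = y i + 2 * pi / real N" if "i < N" for i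
      using that by (auto simp: algebra_simps)
    have yi: "i < N \<Longrightarrow> y i = y 0 + 2 * pi * real i / real N" for i
    proof (induction i)
      case (Suc i)
      then show ?case using step[of i] by (simp add: add_divide_distrib algebra_simps)
    qed simp
    \<comment> \<open>The rotation that carries the first point of \<open>Y\<close> to the first
      point of \<open>Y_tilde N\<close>.\<close>
    define c where "c = pi / real N - y 0"
    have in_Y: "y i \<in> {0<..<2 * pi}" if "i < N" for i
      using bij Y(1) that by (auto simp: bij_betw_def)
    have "pi / real N < pi" using N by (simp add: field_simps)
    moreover have "0 < pi / real N" using N by simp
    moreover have "0 < y 0" "y 0 < 2 * pi" using in_Y[OF N0] by auto
    ultimately have c: "\<bar>c\<bar> < 2 * pi" unfolding c_def by linarith
    have "congruent_sets Y (Y_tilde N)"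
    proof (rule congruent_rotation[OF _ c])
      show "Y \<subseteq> loop" using Y(1) by (auto simp: loop_def)
      have "y i + c = pi / real N * (2 * real i + 1)" if "i < N" for i
        unfolding yi[OF that] c_def by (simp add: algebra_simps add_divide_distrib)
      then show "(\<lambda>y. y + c) ` Y = Y_tilde N"
        unfolding Y_tilde_eq bij_betw_imp_surj_on[OF bij, symmetric] image_image by (intro image_cong) auto
      show "Y_tilde N \<subseteq> loop" using Y_tilde_subset[of N] by (auto simp: loop_def)
    qed
    then show False using nc by simp
  qed
  then obtain i where i: "i < N" "y (i + 1) - y i \<noteq> 2 * pi * real 1 / real N" by blast
  show "energy \<kappa> Y (\<lambda>_. 1) > real N * mean_green N \<kappa>"
    unfolding e mean_green_def sum_distrib_left
    using green_cyclic_sum(2)[OF \<kappa> N0 per i] N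
    by (intro sum_strict_mono_ex1 ballI green_cyclic_sum(1) \<kappa> N0 per bexI[of _ 1]) auto
qed

text \<open>The Schur test: each product of coordinates is bounded by half the sum of their squares,
  and symmetry merges the two halves into row sums.\<close>

lemma quad_le_row_sum:
  fixes G :: "'a \<Rightarrow> 'a \<Rightarrow> real"
  assumes sym: "\<And>x y. G x y = G y x" and nonneg: "\<And>x y. x \<in> Y \<Longrightarrow> y \<in> Y \<Longrightarrow> G x y \<ge> 0"
    and row: "\<And>x. x \<in> Y \<Longrightarrow> (\<Sum>y\<in>Y. G x y) \<le> F"
  shows "quad G Y a \<le> F * (\<Sum>x\<in>Y. (a x)\<^sup>2)"
proof -
  have "quad G Y a \<le> (\<Sum>x\<in>Y. \<Sum>y\<in>Y. G x y * (a x)\<^sup>2 / 2 + G x y * (a y)\<^sup>2 / 2)"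
    unfolding quad_def
  proof (intro sum_mono)
    fix x y assume "x \<in> Y" "y \<in> Y"
    have "a x * a y \<le> (a x)\<^sup>2 / 2 + (a y)\<^sup>2 / 2"
      using zero_le_power2[of "a x - a y"] by (simp add: power2_diff)
    from mult_left_mono[OF this nonneg[OF \<open>x \<in> Y\<close> \<open>y \<in> Y\<close>]]
    show "G x y * a x * a y \<le> G x y * (a x)\<^sup>2 / 2 + G x y * (a y)\<^sup>2 / 2"
      by (simp add: algebra_simps)
  qed
  also have "\<dots> = (\<Sum>x\<in>Y. \<Sum>y\<in>Y. G x y * (a x)\<^sup>2 / 2) + (\<Sum>x\<in>Y. \<Sum>y\<in>Y. G x y * (a y)\<^sup>2 / 2)"
    by (simp add: sum.distrib)
  also have "(\<Sum>x\<in>Y. \<Sum>y\<in>Y. G x y * (a y)\<^sup>2 / 2) = (\<Sum>y\<in>Y. \<Sum>x\<in>Y. G y x * (a y)\<^sup>2 / 2)"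
    by (subst sum.swap) (intro sum.cong refl, metis sym)
  also have "(\<Sum>x\<in>Y. \<Sum>y\<in>Y. G x y * (a x)\<^sup>2 / 2) + \<dots> = (\<Sum>x\<in>Y. (\<Sum>y\<in>Y. G x y) * (a x)\<^sup>2)"
    by (simp add: sum_distrib_right flip: sum.distrib)
  also have "\<dots> \<le> (\<Sum>x\<in>Y. F * (a x)\<^sup>2)"
    using row by (intro sum_mono mult_right_mono) auto
  finally show ?thesis by (simp add: sum_distrib_left)
qed

lemma energy_Y_tilde_le:
  assumes \<kappa>: "\<kappa> > 0" and N: "N > 0"
  shows "energy \<kappa> (Y_tilde N) a \<le> mean_green N \<kappa> * (\<Sum>x\<in>Y_tilde N. (a x)\<^sup>2)"
proof (rule quad_le_row_sum)
  \<comment> \<open>Read for all natural \<open>i\<close>, the formula already advances by 2 pi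
    after \<open>N\<close> steps, so \<open>cyclic_row_sum\<close> applies and every row produces
    the same differences.\<close>
  define y where "y i = pi / real N * (2 * real i + 1)" for i
  have Yt: "Y_tilde N = y ` {..<N}" by (simp add: Y_tilde_eq y_def[abs_def])
  have inj: "inj_on y {..<N}" using N by (auto simp: inj_on_def y_def)
  show "green \<kappa> \<bar>x - z\<bar> = green \<kappa> \<bar>z - x\<bar>" for x z by (simp add: abs_minus_commute)
  show "green \<kappa> \<bar>x - z\<bar> \<ge> 0" if "x \<in> Y_tilde N" "z \<in> Y_tilde N" for x z
  proof (rule green_bounds(1)[OF \<kappa>])
    have "x \<in> {0<..<2 * pi}" "z \<in> {0<..<2 * pi}" using that Y_tilde_subset by blast+
    then show "\<bar>x - z\<bar> \<in> {0..2 * pi}" by auto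
  qed
  fix x assume "x \<in> Y_tilde N"
  then obtain i where i: "x = y i" "i < N" unfolding Yt by auto
  have "(\<Sum>z\<in>Y_tilde N. green \<kappa> \<bar>x - z\<bar>) = (\<Sum>j<N. green \<kappa> \<bar>y i - y j\<bar>)"
    unfolding Yt i(1) by (subst sum.reindex[OF inj]) simp
  also have "\<dots> = (\<Sum>k<N. green \<kappa> (y (i + k) - y i))"
  proof (rule cyclic_row_sum)
    show "y i \<le> y j" if "i \<le> j" "j < N" for i j
      using that N by (simp add: y_def divide_right_mono mult_left_mono)
    show "y (i + N) = y i + 2 * pi" for i using N by (simp add: y_def field_simps)
    show "green \<kappa> (2 * pi - d) = green \<kappa> d" for d by (rule green_symmetric)
    show "i < N" by (rule i(2))
  qed
  also have "\<dots> = mean_green N \<kappa>"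
    unfolding mean_green_def by (intro sum.cong refl) (simp add: y_def algebra_simps diff_divide_distrib[symmetric])
  finally show "(\<Sum>z\<in>Y_tilde N. green \<kappa> \<bar>x - z\<bar>) \<le> mean_green N \<kappa>" by simp
qed

section \<open>The lowest eigenvalue\<close>

text \<open>Matrix entries decay like 1/\<kappa>, so the top eigenvalue drops below any positive
  level. The constant 1 amounts to 3 <= exp (2 \<kappa> pi), for which \<kappa> pi >= 1 is
  enough.\<close>

lemma mult_green_le:
  assumes "\<kappa> \<ge> 1"
  shows "\<kappa> * green \<kappa> 0 \<le> 1"
proof -
  have "1 \<le> \<kappa> * pi" using assms pi_ge_two mult_mono[of 1 \<kappa> 1 pi] by simp
  then have "3 \<le> 1 + 2 * (\<kappa> * pi)" by simp
  also have "\<dots> \<le> exp (2 * (\<kappa> * pi))" by (rule exp_ge_add_one_self)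
  finally have "3 * exp (- (\<kappa> * pi)) \<le> exp (2 * (\<kappa> * pi)) * exp (- (\<kappa> * pi))"
    by (intro mult_right_mono) auto
  also have "\<dots> = exp (\<kappa> * pi)" by (simp flip: exp_add)
  finally have "cosh (\<kappa> * pi) \<le> 2 * sinh (\<kappa> * pi)" by (simp add: cosh_field_def sinh_field_def)
  moreover have "sinh (\<kappa> * pi) > 0" using assms by simp
  ultimately show ?thesis using assms by (simp add: green_def field_simps)
qed

text \<open>Since coth is at least 1, the diagonal entry alone reaches any given level for small
  \<kappa>.\<close>

lemma mult_green_ge:
  assumes "\<kappa> > 0"
  shows "2 * \<kappa> * green \<kappa> 0 \<ge> 1"
proof -
  have "sinh (\<kappa> * pi) > 0" using assms by simp
  moreover have "sinh (\<kappa> * pi) \<le> cosh (\<kappa> * pi)" by (rule sinh_le_cosh_real)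
  ultimately show ?thesis using assms by (simp add: green_def field_simps)
qed

text \<open>With \<open>c = - 1 / \<alpha>\<close>, the number \<open>- \<kappa>\<^sup>2\<close> is the lowest eigenvalue (lemma \<open>lambda1_eq\<close>).\<close>

definition is_critical :: "real \<Rightarrow> real set \<Rightarrow> real \<Rightarrow> bool" where
  "is_critical c Y \<kappa> \<longleftrightarrow> \<kappa> > 0 \<and>
     (\<exists>a. (\<exists>x\<in>Y. a x \<noteq> 0) \<and> energy \<kappa> Y a = c * (\<Sum>x\<in>Y. (a x)\<^sup>2)) \<and>
     (\<forall>a. energy \<kappa> Y a \<le> c * (\<Sum>x\<in>Y. (a x)\<^sup>2)) \<and>
     (\<forall>\<kappa>'>\<kappa>. \<forall>a. (\<exists>x\<in>Y. a x \<noteq> 0) \<longrightarrow> energy \<kappa>' Y a < c * (\<Sum>x\<in>Y. (a x)\<^sup>2))"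

lemma is_critical_exists:
  assumes Y: "Y \<subseteq> {0<..<2 * pi}" "finite Y" "Y \<noteq> {}" and c: "c > 0"
  obtains \<kappa> where "is_critical c Y \<kappa>"
proof -
  obtain y where y: "y \<in> Y" using Y by blast
  \<comment> \<open>Chosen so that \<open>mult_green_ge\<close> gives
    \<open>green k0 0 >= c\<close>; a single coordinate vector then reaches the level.\<close>
  define k0 where "k0 = 1 / (2 * c)"
  have k0: "k0 > 0" using c by (simp add: k0_def)
  let ?e = "\<lambda>x. if x = y then 1 else 0 :: real"
  have sum_e: "(\<Sum>x\<in>Y. f x * ?e x) = f y" for f :: "real \<Rightarrow> real"
  proof -
    have "(\<Sum>x\<in>Y. f x * ?e x) = (\<Sum>x\<in>Y. if x = y then f x else 0)" by (rule sum.cong) auto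
    then show ?thesis using y Y by simp
  qed
  have "energy k0 Y ?e = green k0 0"
    unfolding quad_def sum_e by simp
  moreover have "(\<Sum>x\<in>Y. (?e x)\<^sup>2) = 1"
    using sum_e[of ?e] by (simp add: power2_eq_square)
  moreover have "green k0 0 \<ge> c"
    using mult_green_ge[OF k0] c by (simp add: k0_def field_simps)
  ultimately have start: "energy k0 Y ?e \<ge> c * (\<Sum>x\<in>Y. (?e x)\<^sup>2)" by simp
  have cont: "continuous_on {0<..} (\<lambda>k. green k \<bar>x - z\<bar>)" for x z :: real
    unfolding green_def by (intro continuous_intros) auto
  \<comment> \<open>The summand 1 puts \<open>k\<close> in the range of
    \<open>mult_green_le\<close>; the other summand gives \<open>real (card Y) < c * k\<close>, so
    that every row sum stays below \<open>c\<close>.\<close>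
  have bound: "energy k Y a < c * (\<Sum>x\<in>Y. (a x)\<^sup>2)"
    if k: "k \<ge> 1 + real (card Y) / c" and a: "\<exists>x\<in>Y. a x \<noteq> 0" for k a
  proof -
    have "real (card Y) / c \<ge> 0" using c by simp
    then have k1: "k \<ge> 1" using k by simp
    then have "k > 0" by simp
    have d: "\<bar>x - z\<bar> \<in> {0..2 * pi}" if "x \<in> Y" "z \<in> Y" for x z
    proof -
      have "x \<in> {0<..<2 * pi}" "z \<in> {0<..<2 * pi}" using that Y by blast+
      then show ?thesis by auto
    qed
    have "energy k Y a \<le> real (card Y) * green k 0 * (\<Sum>x\<in>Y. (a x)\<^sup>2)"
    proof (rule quad_le_row_sum)
      fix x assume "x \<in> Y"
      then show "(\<Sum>z\<in>Y. green k \<bar>x - z\<bar>) \<le> real (card Y) * green k 0"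
        using sum_bounded_above[of Y "\<lambda>z. green k \<bar>x - z\<bar>" "green k 0"] green_bounds(2)[OF \<open>k > 0\<close> d] by simp
    qed (simp_all add: abs_minus_commute green_bounds(1)[OF \<open>k > 0\<close> d])
    also have "\<dots> < c * (\<Sum>x\<in>Y. (a x)\<^sup>2)"
    proof (rule mult_strict_right_mono)
      have "real (card Y) < c * k" using k c by (simp add: field_simps)
      then have "real (card Y) * green k 0 < c * k * green k 0"
      proof (rule mult_strict_right_mono)
        have "0 < 2 * k * green k 0" using mult_green_ge[OF \<open>k > 0\<close>] by linarith
        then show "0 < green k 0" using \<open>k > 0\<close> by (simp add: zero_less_mult_iff)
      qed
      also have "\<dots> \<le> c * 1" using mult_green_le[OF k1] c unfolding mult.assoc by (intro mult_left_mono) auto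
      finally show "real (card Y) * green k 0 < c" by simp
      show "0 < (\<Sum>x\<in>Y. (a x)\<^sup>2)" by (rule sum_power2_pos[OF Y(2) a])
    qed
    finally show ?thesis .
  qed
  show thesis
  proof (rule quad_last_crossing[OF Y(2) cont bound k0 _ start])
    show "\<exists>x\<in>Y. ?e x \<noteq> 0" using y by auto
    fix k a
    assume "k \<ge> k0" and *: "\<exists>x\<in>Y. a x \<noteq> 0" "energy k Y a = c * (\<Sum>x\<in>Y. (a x)\<^sup>2)"
      "\<And>a. energy k Y a \<le> c * (\<Sum>x\<in>Y. (a x)\<^sup>2)"
      "\<And>k' a. k' > k \<Longrightarrow> \<exists>x\<in>Y. a x \<noteq> 0 \<Longrightarrow> energy k' Y a < c * (\<Sum>x\<in>Y. (a x)\<^sup>2)"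
    then have "k > 0" using k0 by simp
    then have "is_critical c Y k" unfolding is_critical_def using * by blast
    then show thesis by (rule that)
  qed
qed

text \<open>At the critical parameter a maximizer is an eigenvector, hence \<kappa> yields an
  eigenvalue. A smaller eigenvalue would be negative and have the form - \<kappa>'^2 with \<kappa>'
  > \<kappa>, and its eigenvector would reach level \<open>c\<close> beyond the last
  crossing.\<close>

lemma lambda1_eq:
  assumes Y: "Y \<subseteq> {0<..<2 * pi}" "finite Y" and \<alpha>: "\<alpha> < 0" and crit: "is_critical (- 1 / \<alpha>) Y \<kappa>"
  shows "lambda1 \<alpha> Y = - \<kappa>\<^sup>2"
  unfolding lambda1_def
proof (rule Least_equality)
  define c where "c = - 1 / \<alpha>"
  have c: "- \<alpha> * c = 1" using \<alpha> by (simp add: c_def)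
  have \<kappa>: "\<kappa> > 0" using crit by (simp add: is_critical_def)
  obtain a where a: "\<exists>x\<in>Y. a x \<noteq> 0" "energy \<kappa> Y a = c * (\<Sum>x\<in>Y. (a x)\<^sup>2)"
    using crit unfolding is_critical_def c_def by blast
  have max: "energy \<kappa> Y b \<le> c * (\<Sum>x\<in>Y. (b x)\<^sup>2)" for b
    using crit unfolding is_critical_def c_def by blast
  show "is_eigenvalue \<alpha> Y (- \<kappa>\<^sup>2)"
  proof (rule eigenfunction_of_eigenvector[OF \<kappa> Y(1) _ a(1)])
    fix y assume "y \<in> Y"
    then have "(\<Sum>x\<in>Y. green \<kappa> \<bar>y - x\<bar> * a x) = c * a y"
      by (intro quad_maximizer_eigenvector[OF Y(2) _ max a(2)]) (simp_all add: abs_minus_commute)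
    then have "- \<alpha> * (\<Sum>x\<in>Y. green \<kappa> \<bar>y - x\<bar> * a x) = (- \<alpha> * c) * a y" by simp
    then show "- \<alpha> * (\<Sum>x\<in>Y. green \<kappa> \<bar>y - x\<bar> * a x) = a y"
      unfolding c by simp
  qed
  fix \<mu> assume \<mu>: "is_eigenvalue \<alpha> Y \<mu>"
  show "- \<kappa>\<^sup>2 \<le> \<mu>"
  proof (rule ccontr)
    assume "\<not> - \<kappa>\<^sup>2 \<le> \<mu>"
    then have less: "\<kappa>\<^sup>2 < - \<mu>" by simp
    define \<kappa>' where "\<kappa>' = sqrt (- \<mu>)"
    have "- \<mu> > 0" using less zero_le_power2[of \<kappa>] by linarith
    then have \<kappa>': "\<kappa>' > 0" "\<kappa>'\<^sup>2 = - \<mu>" by (simp_all add: \<kappa>'_def)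
    have gt: "\<kappa> < \<kappa>'"
    proof (rule power2_less_imp_less)
      show "\<kappa>\<^sup>2 < \<kappa>'\<^sup>2" unfolding \<kappa>'(2) by (rule less)
    qed (use \<kappa>'(1) in simp)
    have "is_eigenvalue \<alpha> Y (- \<kappa>'\<^sup>2)" using \<mu> \<kappa>'(2) by simp
    then obtain b where b: "\<And>y. y \<in> Y \<Longrightarrow> - \<alpha> * (\<Sum>x\<in>Y. green \<kappa>' \<bar>y - x\<bar> * b x) = b y" "\<exists>y\<in>Y. b y \<noteq> 0"
      using eigenvector_of_eigenvalue[OF \<kappa>'(1) Y(1)] by blast
    have "energy \<kappa>' Y b = c * (\<Sum>x\<in>Y. (b x)\<^sup>2)"
    proof (rule quad_eigenvector)
      fix y assume "y \<in> Y"
      have "c * b y = (- \<alpha> * c) * (\<Sum>x\<in>Y. green \<kappa>' \<bar>y - x\<bar> * b x)"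
        unfolding b(1)[OF \<open>y \<in> Y\<close>, symmetric] by (simp only: mult_ac)
      then show "(\<Sum>x\<in>Y. green \<kappa>' \<bar>y - x\<bar> * b x) = c * b y"
        unfolding c by simp
    qed
    moreover have "energy \<kappa>' Y b < c * (\<Sum>x\<in>Y. (b x)\<^sup>2)"
      using crit gt b(2) unfolding is_critical_def c_def by blast
    ultimately show False by simp
  qed
qed

section \<open>Invariance under loop isometries and the final comparison\<close>

lemma green_arc_dist:
  "green \<kappa> \<bar>x - y\<bar> = green \<kappa> (arc_dist x y)"
  unfolding arc_dist_def min_def by (simp add: green_symmetric)

text \<open>The matrix depends only on arc distances, so vectors can be pulled back along the
  isometry. Congruent sets thus share critical parameters without any transport of
  eigenfunctions.\<close>

lemma is_critical_congruent:
  assumes "congruent_sets Y Z" "Y \<subseteq> loop" "is_critical c Y \<kappa>"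
  shows "is_critical c Z \<kappa>"
proof -
  obtain f where f: "bij_betw f loop loop" "\<And>x y. x \<in> loop \<Longrightarrow> y \<in> loop \<Longrightarrow> arc_dist (f x) (f y) = arc_dist x y" "f ` Y = Z"
    using assms(1) unfolding congruent_sets_def loop_isometry_def by blast
  have inj: "inj_on f Y" using f(1) assms(2) by (meson bij_betw_imp_inj_on inj_on_subset)
  define g where "g = inv_into Y f"
  have gf: "g (f x) = x" if "x \<in> Y" for x using inj that by (simp add: g_def)
  have energy: "energy k Z a = energy k Y (a \<circ> f)" for k a
    unfolding quad_def f(3)[symmetric] sum.reindex[OF inj] o_def
    using assms(2) by (intro sum.cong refl) (simp add: green_arc_dist f(2) subset_iff)
  have square: "(\<Sum>x\<in>Z. (a x)\<^sup>2) = (\<Sum>x\<in>Y. ((a \<circ> f) x)\<^sup>2)" for a :: "real \<Rightarrow> real"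
    unfolding f(3)[symmetric] sum.reindex[OF inj] by simp
  have nz: "(\<exists>x\<in>Z. a x \<noteq> 0) \<longleftrightarrow> (\<exists>x\<in>Y. (a \<circ> f) x \<noteq> 0)" for a :: "real \<Rightarrow> real"
    unfolding f(3)[symmetric] by simp
  \<comment> \<open>\<open>g\<close> inverts \<open>f\<close> only on \<open>Y\<close>, so the
    pulled-back vector agrees with \<open>a\<close> only there.\<close>
  have cong: "energy k Y a = energy k Y b" "(\<Sum>x\<in>Y. (a x)\<^sup>2) = (\<Sum>x\<in>Y. (b x)\<^sup>2)" "(\<exists>x\<in>Y. a x \<noteq> 0) \<longleftrightarrow> (\<exists>x\<in>Y. b x \<noteq> 0)"
    if "\<And>x. x \<in> Y \<Longrightarrow> a x = b x" for k and a b :: "real \<Rightarrow> real"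
    using that by (auto simp: quad_def)
  obtain a where a: "\<exists>x\<in>Y. a x \<noteq> 0" "energy \<kappa> Y a = c * (\<Sum>x\<in>Y. (a x)\<^sup>2)"
    using assms(3) unfolding is_critical_def by blast
  have "\<exists>b. (\<exists>x\<in>Z. b x \<noteq> 0) \<and> energy \<kappa> Z b = c * (\<Sum>x\<in>Z. (b x)\<^sup>2)"
    unfolding energy square nz using a cong[of "(a \<circ> g) \<circ> f" a] gf by (intro exI[of _ "a \<circ> g"]) simp
  then show ?thesis
    using assms(3) unfolding is_critical_def energy square nz by blast
qed

theorem theorem2p1:
  fixes N :: nat and Y :: "real set" and \<alpha> :: real
  assumes "N \<ge> 2"
    and "Y \<subseteq> {0<..<2 * pi}" and "finite Y" and "card Y = N"
    and "\<alpha> < 0"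
  shows "lambda1 \<alpha> Y \<le> lambda1 \<alpha> (Y_tilde N) \<and>
    (lambda1 \<alpha> Y < lambda1 \<alpha> (Y_tilde N) \<longleftrightarrow> \<not> congruent_sets Y (Y_tilde N))"
proof -
  define c where "c = - 1 / \<alpha>"
  have c: "c > 0" using \<open>\<alpha> < 0\<close> by (simp add: c_def divide_neg_neg)
  have Z: "Y_tilde N \<subseteq> {0<..<2 * pi}" "finite (Y_tilde N)" "Y_tilde N \<noteq> {}"
    using Y_tilde_subset \<open>N \<ge> 2\<close> by (auto simp: Y_tilde_def)
  have "Y \<noteq> {}" using assms(1,4) by auto
  then obtain \<kappa> where \<kappa>: "is_critical c Y \<kappa>" using is_critical_exists[OF assms(2,3) _ c] by blast
  obtain \<kappa>' where \<kappa>': "is_critical c (Y_tilde N) \<kappa>'" using is_critical_exists[OF Z c] by blast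
  have lam: "lambda1 \<alpha> Y = - \<kappa>\<^sup>2" "lambda1 \<alpha> (Y_tilde N) = - \<kappa>'\<^sup>2"
    using lambda1_eq[OF assms(2,3,5)] lambda1_eq[OF Z(1,2) assms(5)] \<kappa> \<kappa>' unfolding c_def by blast+
  have pos: "\<kappa> > 0" "\<kappa>' > 0" using \<kappa> \<kappa>' unfolding is_critical_def by blast+
  show ?thesis
  proof (cases "congruent_sets Y (Y_tilde N)")
    case True
    then have "is_critical c (Y_tilde N) \<kappa>"
      using assms(2) by (intro is_critical_congruent[OF _ _ \<kappa>]) (auto simp: loop_def)
    then have "lambda1 \<alpha> (Y_tilde N) = - \<kappa>\<^sup>2"
      using lambda1_eq[OF Z(1,2) assms(5)] unfolding c_def by blast
    then show ?thesis using True lam(1) by simp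
  next
    case False
    \<comment> \<open>Reaching level \<open>c\<close> at \<kappa>' against the row sum bound shows
      that \<open>c\<close> is at most \<open>mean_green N \<kappa>'\<close>.\<close>
    obtain a where a: "\<exists>x\<in>Y_tilde N. a x \<noteq> 0" "energy \<kappa>' (Y_tilde N) a = c * (\<Sum>x\<in>Y_tilde N. (a x)\<^sup>2)"
      using \<kappa>' unfolding is_critical_def by blast
    have "(\<Sum>x\<in>Y_tilde N. (a x)\<^sup>2) > 0" by (rule sum_power2_pos[OF Z(2) a(1)])
    moreover have "c * (\<Sum>x\<in>Y_tilde N. (a x)\<^sup>2) \<le> mean_green N \<kappa>' * (\<Sum>x\<in>Y_tilde N. (a x)\<^sup>2)"
      using energy_Y_tilde_le[OF pos(2), of N a] a(2) \<open>N \<ge> 2\<close> by simp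
    ultimately have "c \<le> mean_green N \<kappa>'" by simp
    then have "c * (\<Sum>x\<in>Y. 1\<^sup>2) \<le> real N * mean_green N \<kappa>'"
      using assms(4) \<open>N \<ge> 2\<close> by (simp add: mult.commute)
    also have "\<dots> < energy \<kappa>' Y (\<lambda>_. 1)"
      using energy_one_gt[OF pos(2) assms(1,2,3,4) False] .
    finally have gt: "c * (\<Sum>x\<in>Y. 1\<^sup>2) < energy \<kappa>' Y (\<lambda>_. 1)" .
    \<comment> \<open>Equality would contradict the maximality of level \<open>c\<close> for
      \<open>Y\<close> at \<kappa>, and \<kappa> < \<kappa>' would contradict \<kappa> being its
      last crossing.\<close>
    have "\<kappa>' < \<kappa>"
    proof (rule ccontr)
      assume "\<not> \<kappa>' < \<kappa>"
      then consider "\<kappa>' = \<kappa>" | "\<kappa> < \<kappa>'" by linarith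
      then have "energy \<kappa>' Y (\<lambda>_. 1) \<le> c * (\<Sum>x\<in>Y. 1\<^sup>2)"
      proof cases
        case 1
        have "\<forall>a. energy \<kappa> Y a \<le> c * (\<Sum>x\<in>Y. (a x)\<^sup>2)"
          using \<kappa> unfolding is_critical_def by blast
        from this[rule_format, of "\<lambda>_. 1"] show ?thesis unfolding 1 .
      next
        case 2
        have "\<forall>\<kappa>'>\<kappa>. \<forall>a. (\<exists>x\<in>Y. a x \<noteq> 0) \<longrightarrow> energy \<kappa>' Y a < c * (\<Sum>x\<in>Y. (a x)\<^sup>2)"
          using \<kappa> unfolding is_critical_def by blast
        from this[rule_format, OF 2, of "\<lambda>_. 1"] show ?thesis using \<open>Y \<noteq> {}\<close> by fastforce
      qed
      then show False using gt by simp
    qed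
    then have "\<kappa>'\<^sup>2 < \<kappa>\<^sup>2" using pos by (intro power_strict_mono) auto
    then show ?thesis using False lam by simp
  qed
qed

end
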